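(* Let $E,F$ be Banach spaces and for $X\in B(E,F)$ let $M(X)=\{T\in B(E,F): T\,N(X)\subset R(X)\}$. Each of $F_k$ $(k<\infty)$, $\Phi_{m,n}$ $(m,n<\infty)$, $\Phi_{m,\infty}$ $(m<\infty)$ and $\Phi_{\infty,n}$ $(n<\infty)$ is a smooth submanifold in $B(E,F)$ and is tangent to $M(X)$ at any $X$ in it.
   Context: $B(E,F)$ is the Banach space of bounded linear operators from $E$ to $F$; $N(T)$, $R(T)$ denote kernel and range. $T\in B(E,F)$ is double splitting if $R(T)$ is closed and there are closed subspaces $R^+\subset E$, $N^+\subset F$ with $E=N(T)\oplus R^+$ and $F=R(T)\oplus N^+$. $F_k=\{T\in B(E,F): \operatorname{rank}T=k\}$ for $k<\infty$. For $m,n\in\{0,1,2,\dots\}$: $\Phi_{m,n}$ is the set of double splitting $T\in B(E,F)$ with $\dim N(T)=m$ and $\operatorname{codim}R(T)=n$; $\Phi_{m,\infty}$ is the set of double splitting $T$ with $\dim N(T)=m$ and $\operatorname{codim}R(T)=\infty$; $\Phi_{\infty,n}$ is the set of double splitting $T$ with $\dim N(T)=\infty$ and $\operatorname{codim}R(T)=n$. Smooth submanifold: a subset $S$ of a Banach space $G$ is a smooth ($C^\infty$) submanifold if for each $p\in S$ there are a closed complemented subspace $G_0\subset G$, an open neighborhood $W$ of $p$ in $G$, and a $C^\infty$ diffeomorphism $\varphi:W\to\varphi(W)$ onto an open subset of $G$ such that $\varphi(S\cap W)$ is an open set in $G_0$. Tangency: $S\subset B(E,F)$ is tangent to $M(X)$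 at $X\in S$ if $M(X)=\{\dot c(0): c \text{ a } C^1\text{-curve},\ c(t)\in S,\ c(0)=X\}$. *)

theory Defs
  imports "HOL-Analysis.Analysis" "HOL-Library.Extended_Nat"
begin

section \<open>Smooth maps between Banach spaces\<close>

text \<open>
  The \<open>n\<close>-th Frechet derivative of a map into \<open>'b\<close> at a point is a bounded \<open>n\<close>-linear map, here
  represented as a function on argument lists of length \<open>n\<close> (its values on lists of other lengths are
  irrelevant). This avoids the tower of types \<open>'a \<Rightarrow>\<^sub>L 'b\<close>, \<open>'a \<Rightarrow>\<^sub>L ('a \<Rightarrow>\<^sub>L 'b)\<close>, \<open>...\<close>, over which one
  cannot quantify in HOL.
\<close>

definition bounded_multilinear ::
  "nat \<Rightarrow> ('a::real_normed_vector list \<Rightarrow> 'b::real_normed_vector) \<Rightarrow> bool" where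
  "bounded_multilinear n A \<longleftrightarrow>
     (\<forall>us ws. Suc (length us + length ws) = n \<longrightarrow> linear (\<lambda>v. A (us @ v # ws))) \<and>
     (\<exists>C. \<forall>vs. length vs = n \<longrightarrow> norm (A vs) \<le> C * (\<Prod>v\<leftarrow>vs. norm v))"

text \<open>
  The map \<open>x \<mapsto> A x\<close>, with \<open>n\<close>-linear values, is Frechet differentiable at \<open>x\<close> with respect to the
  operator norm of \<open>n\<close>-linear maps, and the derivative is \<open>h \<mapsto> (vs \<mapsto> A' (h # vs))\<close>.
\<close>

definition has_multilinear_derivative ::
  "nat \<Rightarrow> ('a::real_normed_vector \<Rightarrow> 'a list \<Rightarrow> 'b::real_normed_vector) \<Rightarrow> ('a list \<Rightarrow> 'b) \<Rightarrow> 'a \<Rightarrow> bool"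
  where
  "has_multilinear_derivative n A A' x \<longleftrightarrow>
     (\<forall>\<epsilon>>0. \<exists>\<delta>>0. \<forall>h. norm h < \<delta> \<longrightarrow>
        (\<forall>vs. length vs = n \<longrightarrow>
           norm (A (x + h) vs - A x vs - A' (h # vs)) \<le> \<epsilon> * norm h * (\<Prod>v\<leftarrow>vs. norm v)))"

text \<open>
  \<open>C\<^sup>\<infinity>\<close> maps on an open set \<open>U\<close>: Frechet derivatives of all orders exist. Continuity of each
  derivative follows from the existence of the next one.
\<close>

definition smooth_on ::
  "'a::real_normed_vector set \<Rightarrow> ('a \<Rightarrow> 'b::real_normed_vector) \<Rightarrow> bool" where
  "smooth_on U f \<longleftrightarrow>
     (\<exists>D :: nat \<Rightarrow> 'a \<Rightarrow> 'a list \<Rightarrow> 'b.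
        (\<forall>x\<in>U. D 0 x [] = f x) \<and>
        (\<forall>n. \<forall>x\<in>U. bounded_multilinear n (D n x) \<and>
                     has_multilinear_derivative n (D n) (D (Suc n) x) x))"

definition smooth_diffeo_on ::
  "'a::real_normed_vector set \<Rightarrow> ('a \<Rightarrow> 'b::real_normed_vector) \<Rightarrow> bool" where
  "smooth_diffeo_on W \<phi> \<longleftrightarrow>
     open W \<and> open (\<phi> ` W) \<and> inj_on \<phi> W \<and> smooth_on W \<phi> \<and> smooth_on (\<phi> ` W) (inv_into W \<phi>)"

section \<open>Complements, dimension and codimension\<close>

definition complementary :: "'a::real_vector set \<Rightarrow> 'a set \<Rightarrow> bool" where
  "complementary V W \<longleftrightarrow>
     subspace V \<and> subspace W \<and> V \<inter> W = {0} \<and> (\<forall>x. \<exists>v\<in>V. \<exists>w\<in>W. x = v + w)"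

definition closed_complemented :: "'a::real_normed_vector set \<Rightarrow> bool" where
  "closed_complemented V \<longleftrightarrow> closed V \<and> (\<exists>W. closed W \<and> complementary V W)"

text \<open>The library's \<^const>\<open>dim\<close> is \<open>0\<close> on infinite-dimensional subspaces.\<close>

definition edim :: "'a::real_vector set \<Rightarrow> enat" where
  "edim V = (if \<exists>B. finite B \<and> span B = V then enat (dim V) else \<infinity>)"

text \<open>
  The codimension of a subspace is the dimension of any algebraic (not necessarily closed) complement.
\<close>

definition has_codim :: "'a::real_vector set \<Rightarrow> enat \<Rightarrow> bool" where
  "has_codim V d \<longleftrightarrow> (\<exists>W. complementary V W \<and> edim W = d)"

section \<open>Submanifolds and tangency\<close>

definition smooth_submanifold :: "'a::banach set \<Rightarrow> bool" where
  "smooth_submanifold S \<longleftrightarrow>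
     (\<forall>p\<in>S. \<exists>G\<^sub>0 W. \<exists>\<phi> :: 'a \<Rightarrow> 'a.
        closed_complemented G\<^sub>0 \<and> open W \<and> p \<in> W \<and> smooth_diffeo_on W \<phi> \<and>
        \<phi> ` (S \<inter> W) \<subseteq> G\<^sub>0 \<and> openin (top_of_set G\<^sub>0) (\<phi> ` (S \<inter> W)))"

definition tangent_at :: "'a::real_normed_vector set \<Rightarrow> 'a \<Rightarrow> 'a set \<Rightarrow> bool" where
  "tangent_at S X M \<longleftrightarrow>
     M = {vector_derivative c (at 0) | c \<epsilon>.
            \<epsilon> > (0::real) \<and> c C1_differentiable_on {-\<epsilon><..<\<epsilon>} \<and>
            (\<forall>t\<in>{-\<epsilon><..<\<epsilon>}. c t \<in> S) \<and> c 0 = X}"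

section \<open>Classes of operators\<close>

definition kernel :: "('a::real_normed_vector \<Rightarrow>\<^sub>L 'b::real_normed_vector) \<Rightarrow> 'a set" where
  "kernel T = {x. blinfun_apply T x = 0}"

abbreviation op_range :: "('a::real_normed_vector \<Rightarrow>\<^sub>L 'b::real_normed_vector) \<Rightarrow> 'b set" where
  "op_range T \<equiv> range (blinfun_apply T)"

definition double_splitting :: "('a::banach \<Rightarrow>\<^sub>L 'b::banach) \<Rightarrow> bool" where
  "double_splitting T \<longleftrightarrow>
     closed (op_range T) \<and>
     (\<exists>R'. closed R' \<and> complementary (kernel T) R') \<and>
     (\<exists>N'. closed N' \<and> complementary (op_range T) N')"

definition rank_class :: "nat \<Rightarrow> ('a::banach \<Rightarrow>\<^sub>L 'b::banach) set" where
  "rank_class k = {T. edim (op_range T) = enat k}"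

definition Phi :: "enat \<Rightarrow> enat \<Rightarrow> ('a::banach \<Rightarrow>\<^sub>L 'b::banach) set" where
  "Phi m n = {T. double_splitting T \<and> edim (kernel T) = m \<and> has_codim (op_range T) n}"

definition M_space :: "('a::banach \<Rightarrow>\<^sub>L 'b::banach) \<Rightarrow> ('a \<Rightarrow>\<^sub>L 'b) set" where
  "M_space X = {T. blinfun_apply T ` kernel X \<subseteq> op_range X}"

end

theory Submission
  imports Defs
begin

text \<open>
  Let \<open>A\<close> be a generalized inverse of \<open>X\<close>, i.e. \<open>X A X = X\<close> and \<open>A X A = A\<close>. On the set of all \<open>T\<close> with
  \<open>1 + (T - X) A\<close> invertible, the chart is \<open>\<phi> T = (1 + (T - X) A)\<^sup>-\<^sup>1 (T - X)\<close>, whose inverse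
  \<open>Z \<mapsto> X + (1 - Z A)\<^sup>-\<^sup>1 Z\<close> has the same shape. In the algebra of operators with product \<open>Y A Z\<close> both are
  quasi-inverses up to translation; the quasi-inverse \<open>g\<close> solves the quadratic differential equation
  \<open>g' v = v - g v - v g + g v g\<close>, so all its derivatives are polynomials in \<open>g\<close> and the directions.
  Up to invertible factors on both sides \<open>T\<close> equals \<open>X + U\<close> with \<open>U = (1 - X A) (\<phi> T) (1 - A X)\<close>. The
  classes in question are invariant under such factors, and comparing kernels or ranges shows that
  they contain \<open>X + U\<close> only if \<open>U = 0\<close>, i.e. \<open>\<phi> T \<in> M(X)\<close>. A vector \<open>Z\<close> of \<open>M(X)\<close> is the velocity of the
  curve \<open>(1 + t Z A) X (1 + t A Z (1 - A X))\<close> in the orbit of \<open>X\<close>.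
\<close>

section \<open>Smoothness of solutions of a quadratic differential equation\<close>

text \<open>Origin of the factorization: with \<open>H = T - X\<close> and
  \<open>g = (1 + H A)^-1 H\<close> one has \<open>(1 + H A)^-1 (X + H) = X + g (1 - A X)\<close>.
  The part of \<open>g (1 - A X)\<close> inside the range of \<open>X\<close> is \<open>X V\<close>
  with \<open>V = A g (1 - A X)\<close> and \<open>V V = 0\<close>; it moves into the right factor
  \<open>1 + V\<close>. Only the block of \<open>g\<close> from the kernel of \<open>X\<close> to
  the kernel of \<open>A\<close> remains. Finiteness enters at one point: for such a block
  \<open>U\<close> the kernel of \<open>X + U\<close> lies in that of \<open>X\<close>, and the
  range of \<open>X\<close> in that of \<open>X + U\<close>. Equal finite dimension or codimension
  turns one of these inclusions into an equality, and either equality forces \<open>U = 0\<close>. A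
  bounded \<open>A\<close> has two sources: the open mapping theorem when closed complements are
  given, and Hahn-Banach for finite rank, where none are given.\<close>

lemma smooth_onI_derivative_class:
  assumes start: "P 0 A0" "\<And>x. x \<in> U \<Longrightarrow> A0 x [] = f x"
    and bounded: "\<And>n A x. P n A \<Longrightarrow> x \<in> U \<Longrightarrow> bounded_multilinear n (A x)"
    and deriv: "\<And>n A. P n A \<Longrightarrow>
      \<exists>A'. P (Suc n) A' \<and> (\<forall>x\<in>U. has_multilinear_derivative n A (A' x) x)"
  shows "smooth_on U f"
proof -
  obtain D where D: "D 0 = A0" "\<And>n. P n (D n)"
    and D': "\<And>n. \<forall>x\<in>U. has_multilinear_derivative n (D n) (D (Suc n) x) x"
  proof -
    \<comment> \<open>Dependent choice: \<open>F\<close> picks a derivative inside the class, and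
      iterating it gives one coherent sequence. Smoothness is thereby reduced to a single
      differentiation step within a suitable class.\<close>
    define F where "F n A = (SOME A'. P (Suc n) A' \<and>
      (\<forall>x\<in>U. has_multilinear_derivative n A (A' x) x))" for n A
    have F: "P (Suc n) (F n A) \<and> (\<forall>x\<in>U. has_multilinear_derivative n A (F n A x) x)"
      if "P n A" for n A
      unfolding F_def by (rule someI_ex[OF deriv[OF that]])
    define D where "D = rec_nat A0 F"
    have "P n (D n)" for n
      by (induction n) (use start F in \<open>auto simp: D_def\<close>)
    moreover have "D (Suc n) = F n (D n)" for n
      by (simp add: D_def)
    ultimately show thesis
      using F by (intro that[of D]) (auto simp: D_def)
  qed
  show ?thesis
    unfolding smooth_on_def
    using D D' bounded start(2) by (intro exI[of _ D]) auto
qed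

lemma smooth_on_add_const:
  assumes "smooth_on U f"
  shows "smooth_on U (\<lambda>x. f x + c)"
proof -
  obtain D where D: "\<And>x. x \<in> U \<Longrightarrow> D 0 x [] = f x"
      "\<And>n x. x \<in> U \<Longrightarrow> bounded_multilinear n (D n x) \<and>
         has_multilinear_derivative n (D n) (D (Suc n) x) x"
    using assms unfolding smooth_on_def by blast
  define D' where "D' n x vs = (if n = 0 then D n x vs + c else D n x vs)" for n :: nat and x vs
  have "bounded_multilinear n (D' n x)" if "x \<in> U" for n x
  proof (cases n)
    case 0
    then show ?thesis
      by (auto simp: bounded_multilinear_def D'_def)
  next
    case (Suc m)
    then have "D' n x = D n x"
      by (auto simp: D'_def)
    with D(2)[OF that, of n] show ?thesis
      by simp
  qed
  moreover have "has_multilinear_derivative n (D' n) (D' (Suc n) x) x" if "x \<in> U" for n x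
  proof -
    have "D' n (x + h) vs - D' n x vs - D' (Suc n) x (h # vs) =
        D n (x + h) vs - D n x vs - D (Suc n) x (h # vs)" for h vs
      by (simp add: D'_def)
    then show ?thesis
      using D(2)[OF that, of n] by (simp add: has_multilinear_derivative_def)
  qed
  ultimately show ?thesis
    unfolding smooth_on_def using D(1) by (intro exI[of _ D']) (auto simp: D'_def)
qed

lemma smooth_on_cong:
  assumes "smooth_on U f" "\<And>x. x \<in> U \<Longrightarrow> f x = g x"
  shows "smooth_on U g"
  using assms unfolding smooth_on_def by metis

lemma smooth_on_translate:
  assumes "smooth_on U f"
  shows "smooth_on {x. x - c \<in> U} (\<lambda>x. f (x - c))"
proof -
  obtain D where D: "\<And>x. x \<in> U \<Longrightarrow> D 0 x [] = f x"
      "\<And>n x. x \<in> U \<Longrightarrow> bounded_multilinear n (D n x) \<and>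
         has_multilinear_derivative n (D n) (D (Suc n) x) x"
    using assms unfolding smooth_on_def by blast
  have "has_multilinear_derivative n (\<lambda>x. D n (x - c)) (D (Suc n) (x - c)) x" if "x - c \<in> U" for n x
    using D(2)[OF that, of n] unfolding has_multilinear_derivative_def
    by (simp add: add_diff_eq[symmetric] diff_add_eq)
  then show ?thesis
    unfolding smooth_on_def using D by (intro exI[of _ "\<lambda>n x. D n (x - c)"]) auto
qed

section \<open>Multilinear expressions in the solution and their derivatives\<close>

text \<open>For \<open>g x = 1 - (1 + x)^-1\<close> in an algebra with unit, the derivative in
  direction \<open>h\<close> is \<open>(1 - g x) h (1 - g x)\<close>; the equation is this product
  multiplied out.\<close>

locale quadratic_ode = bounded_bilinear mult
  for mult :: "'a::real_normed_vector \<Rightarrow> 'a \<Rightarrow> 'a"  (infixl "\<star>" 70) +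
  fixes U :: "'a set" and g :: "'a \<Rightarrow> 'a"
  assumes ode: "x \<in> U \<Longrightarrow>
    (g has_derivative (\<lambda>h. h - g x \<star> h - (h \<star> g x - (g x \<star> h) \<star> g x))) (at x)"
begin

text \<open>The index set records the argument slots in use. Disjointness in \<open>mult\<close>
  puts each slot of a product into exactly one factor, which yields multilinearity.
  \<open>zero\<close> exists for every finite set because the derivative of \<open>arg\<close>
  vanishes but must still own both slots.\<close>

inductive fam :: "nat set \<Rightarrow> ('a \<Rightarrow> (nat \<Rightarrow> 'a) \<Rightarrow> 'a) \<Rightarrow> bool" where
  sol: "fam {} (\<lambda>x v. g x)"
| arg: "fam {i} (\<lambda>x v. v i)"
| zero: "finite I \<Longrightarrow> fam I (\<lambda>x v. 0)"
| diff: "fam I A \<Longrightarrow> fam I B \<Longrightarrow> fam I (\<lambda>x v. A x v - B x v)"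
| mult: "fam I A \<Longrightarrow> fam J B \<Longrightarrow> I \<inter> J = {} \<Longrightarrow> fam (I \<union> J) (\<lambda>x v. A x v \<star> B x v)"

lemma fam_finite: "fam I A \<Longrightarrow> finite I"
  by (induction rule: fam.induct) auto

lemma fam_add:
  assumes "fam I A" "fam I B"
  shows "fam I (\<lambda>x v. A x v + B x v)"
proof -
  have "fam I (\<lambda>x v. A x v - (0 - B x v))"
    by (intro fam.diff fam.zero assms fam_finite[OF assms(1)])
  then show ?thesis
    by simp
qed

lemma fam_cong_args: "fam I A \<Longrightarrow> (\<And>i. i \<in> I \<Longrightarrow> v i = w i) \<Longrightarrow> A x v = A x w"
  by (induction rule: fam.induct) auto

text \<open>In a product the slot lies in exactly one factor; by \<open>fam_cong_args\<close> the
  other factor does not depend on it.\<close>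

lemma fam_linear: "fam I A \<Longrightarrow> i \<in> I \<Longrightarrow> linear (\<lambda>u. A x (v(i := u)))"
proof (induction rule: fam.induct)
  case (arg j)
  then show ?case
    by (auto intro!: linearI)
next
  case (zero I)
  then show ?case
    by (auto intro!: linearI)
next
  case (diff I A B)
  then show ?case
    by (auto intro!: linear_compose_sub)
next
  case (mult I A J B)
  show ?case
  proof (cases "i \<in> I")
    case True
    then have "B x (v(i := u)) = B x v" for u
      using mult by (intro fam_cong_args[OF \<open>fam J B\<close>]) auto
    moreover have "linear (\<lambda>u. A x (v(i := u)) \<star> B x v)"
      using linear_compose[OF mult.IH(1)[OF True] bounded_linear.linear[OF bounded_linear_left]]
      unfolding o_def .
    ultimately show ?thesis
      by (simp only:)
  next
    case False
    then have "i \<in> J"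
      using mult by auto
    have "A x (v(i := u)) = A x v" for u
      using False by (intro fam_cong_args[OF \<open>fam I A\<close>]) auto
    moreover have "linear (\<lambda>u. A x v \<star> B x (v(i := u)))"
      using linear_compose[OF mult.IH(2)[OF \<open>i \<in> J\<close>] bounded_linear.linear[OF bounded_linear_right]]
      unfolding o_def .
    ultimately show ?thesis
      by (simp only:)
  qed
qed auto

lemma fam_bounded: "fam I A \<Longrightarrow> \<exists>C\<ge>0. \<forall>v. norm (A x v) \<le> C * (\<Prod>i\<in>I. norm (v i))"
proof (induction rule: fam.induct)
  case sol
  show ?case
    by (auto intro!: exI[of _ "norm (g x)"])
next
  case (arg i)
  show ?case
    by (auto intro!: exI[of _ 1])
next
  case (zero I)
  show ?case
    by (auto intro!: exI[of _ 0])
next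
  case (diff I A B)
  then obtain C D where "C \<ge> 0" "D \<ge> 0"
    and CD: "\<And>v. norm (A x v) \<le> C * (\<Prod>i\<in>I. norm (v i))"
      "\<And>v. norm (B x v) \<le> D * (\<Prod>i\<in>I. norm (v i))"
    by auto
  then have "norm (A x v - B x v) \<le> (C + D) * (\<Prod>i\<in>I. norm (v i))" for v
    unfolding distrib_right by (intro order_trans[OF norm_triangle_ineq4] add_mono CD)
  with \<open>C \<ge> 0\<close> \<open>D \<ge> 0\<close> show ?case
    by (intro exI[of _ "C + D"]) auto
next
  case (mult I A J B)
  then obtain C D where "C \<ge> 0" "D \<ge> 0"
    and CD: "\<And>v. norm (A x v) \<le> C * (\<Prod>i\<in>I. norm (v i))"
      "\<And>v. norm (B x v) \<le> D * (\<Prod>i\<in>J. norm (v i))"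
    by auto
  obtain K where "K \<ge> 0" and K: "\<And>a b. norm (a \<star> b) \<le> norm a * norm b * K"
    using nonneg_bounded by blast
  have "norm (A x v \<star> B x v) \<le> (C * D * K) * (\<Prod>i\<in>I \<union> J. norm (v i))" for v
  proof -
    have "norm (A x v \<star> B x v) \<le> (C * (\<Prod>i\<in>I. norm (v i))) * (D * (\<Prod>i\<in>J. norm (v i))) * K"
      using K[of "A x v" "B x v"]
      by (rule order_trans)
        (intro mult_right_mono mult_mono CD \<open>K \<ge> 0\<close> \<open>C \<ge> 0\<close> norm_ge_zero mult_nonneg_nonneg prod_nonneg)
    then show ?thesis
      using mult.hyps by (simp add: prod.union_disjoint fam_finite ac_simps)
  qed
  with \<open>C \<ge> 0\<close> \<open>D \<ge> 0\<close> \<open>K \<ge> 0\<close> show ?case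
    by (intro exI[of _ "C * D * K"]) auto
qed

text \<open>One assignment \<open>v\<close> carries the old arguments in the slots of
  \<open>I\<close> and the increment of \<open>x\<close> in slot \<open>k\<close>. The bound is
  uniform in the old arguments, as convergence in the operator norm demands.\<close>

definition fam_deriv :: "nat set \<Rightarrow> nat \<Rightarrow> ('a \<Rightarrow> (nat \<Rightarrow> 'a) \<Rightarrow> 'a) \<Rightarrow> ('a \<Rightarrow> (nat \<Rightarrow> 'a) \<Rightarrow> 'a) \<Rightarrow> bool" where
  "fam_deriv I k A A' \<longleftrightarrow> (\<forall>x\<in>U. \<forall>\<epsilon>>0. \<exists>\<delta>>0. \<forall>v. norm (v k) < \<delta> \<longrightarrow>
     norm (A (x + v k) v - A x v - A' x v) \<le> \<epsilon> * norm (v k) * (\<Prod>i\<in>I. norm (v i)))"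

lemma fam_deriv_mult:
  assumes fam: "fam I A" "fam J B" "fam (insert k I) A'" "fam (insert k J) B'"
    and k: "I \<inter> J = {}" "k \<notin> I" "k \<notin> J"
    and AB: "fam_deriv I k A A'" "fam_deriv J k B B'"
  shows "fam_deriv (I \<union> J) k (\<lambda>x v. A x v \<star> B x v)
    (\<lambda>x v. A' x v \<star> B x v + A x v \<star> B' x v)"
  unfolding fam_deriv_def
proof (intro ballI allI impI)
  fix x and \<epsilon> :: real
  assume "x \<in> U" "\<epsilon> > 0"
  have fin: "finite I" "finite J"
    using fam fam_finite by blast+
  obtain K where "K \<ge> 0" and K: "\<And>a b. norm (a \<star> b) \<le> norm a * norm b * K"
    using nonneg_bounded by blast
  obtain a where "a \<ge> 0" and a: "\<And>v. norm (A x v) \<le> a * (\<Prod>i\<in>I. norm (v i))"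
    using fam_bounded[OF fam(1)] by blast
  obtain b where "b \<ge> 0" and b: "\<And>v. norm (B x v) \<le> b * (\<Prod>i\<in>J. norm (v i))"
    using fam_bounded[OF fam(2)] by blast
  obtain a' where "a' \<ge> 0" and a': "\<And>v. norm (A' x v) \<le> a' * (\<Prod>i\<in>insert k I. norm (v i))"
    using fam_bounded[OF fam(3)] by blast
  obtain b' where "b' \<ge> 0" and b': "\<And>v. norm (B' x v) \<le> b' * (\<Prod>i\<in>insert k J. norm (v i))"
    using fam_bounded[OF fam(4)] by blast
  \<comment> \<open>The error of the product rule splits into three terms with coefficients
    \<open>K (b + 1 + b')\<close>, \<open>K a' (1 + b')\<close> and \<open>K a\<close>;
    \<open>L\<close> is their sum, plus \<open>1\<close> for positivity. In the middle term, which
    is quadratic in \<open>h\<close>, one factor \<open>h\<close> is estimated by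
    \<open>\<eta>\<close>.\<close>
  define L where "L = K * (b + 1 + b' + a + a' * (1 + b')) + 1"
  have "L > 0"
    unfolding L_def using \<open>K \<ge> 0\<close> \<open>a \<ge> 0\<close> \<open>b \<ge> 0\<close> \<open>a' \<ge> 0\<close> \<open>b' \<ge> 0\<close>
    by (intro add_nonneg_pos mult_nonneg_nonneg) auto
  define \<eta> where "\<eta> = min 1 (\<epsilon> / L)"
  have \<eta>: "\<eta> > 0" "\<eta> \<le> 1" "\<eta> * L \<le> \<epsilon>"
    using \<open>\<epsilon> > 0\<close> \<open>L > 0\<close> by (auto simp: \<eta>_def min_def field_simps)
  obtain d1 where "d1 > 0" and d1: "\<And>v. norm (v k) < d1 \<Longrightarrow>
      norm (A (x + v k) v - A x v - A' x v) \<le> \<eta> * norm (v k) * (\<Prod>i\<in>I. norm (v i))"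
    using AB(1) \<open>x \<in> U\<close> \<eta>(1) unfolding fam_deriv_def by meson
  obtain d2 where "d2 > 0" and d2: "\<And>v. norm (v k) < d2 \<Longrightarrow>
      norm (B (x + v k) v - B x v - B' x v) \<le> \<eta> * norm (v k) * (\<Prod>i\<in>J. norm (v i))"
    using AB(2) \<open>x \<in> U\<close> \<eta>(1) unfolding fam_deriv_def by meson
  show "\<exists>\<delta>>0. \<forall>v. norm (v k) < \<delta> \<longrightarrow>
     norm (A (x + v k) v \<star> B (x + v k) v - A x v \<star> B x v - (A' x v \<star> B x v + A x v \<star> B' x v))
       \<le> \<epsilon> * norm (v k) * (\<Prod>i\<in>I \<union> J. norm (v i))"
  proof (intro exI[of _ "min \<eta> (min d1 d2)"] conjI allI impI)
    fix v :: "nat \<Rightarrow> 'a"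
    assume "norm (v k) < min \<eta> (min d1 d2)"
    define h p q where "h = norm (v k)" "p = (\<Prod>i\<in>I. norm (v i))" "q = (\<Prod>i\<in>J. norm (v i))"
    have h: "0 \<le> h" "h \<le> \<eta>" "h \<le> 1" "h < d1" "h < d2" and "p \<ge> 0" "q \<ge> 0"
      using \<open>norm (v k) < _\<close> \<eta> by (auto simp: h_p_q_def prod_nonneg)
    define rA rB dB where "rA = A (x + v k) v - A x v - A' x v"
      "rB = B (x + v k) v - B x v - B' x v" "dB = B (x + v k) v - B x v"
    have rA: "norm rA \<le> \<eta> * h * p" and rB: "norm rB \<le> \<eta> * h * q"
      using d1[of v] d2[of v] h by (auto simp: rA_rB_dB_def h_p_q_def)
    have nA: "norm (A x v) \<le> a * p" and nB: "norm (B x v) \<le> b * q"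
      using a b by (auto simp: h_p_q_def)
    have nA': "norm (A' x v) \<le> a' * h * p" and nB': "norm (B' x v) \<le> b' * h * q"
      using a'[of v] b'[of v] k fin by (auto simp: h_p_q_def mult.assoc)
    have "dB = rB + B' x v"
      by (simp add: rA_rB_dB_def)
    then have "norm dB \<le> \<eta> * h * q + b' * h * q"
      using norm_triangle_ineq[of rB "B' x v"] rB nB' by auto
    also have "\<dots> \<le> 1 * h * q + b' * h * q"
      using \<eta> h \<open>q \<ge> 0\<close> by (intro add_right_mono mult_right_mono) auto
    finally have dB: "norm dB \<le> (1 + b') * h * q"
      by (simp add: algebra_simps)
    have "norm (B (x + v k) v) \<le> b * q + (1 + b') * h * q"
      using norm_triangle_ineq[of "B x v" dB] nB dB by (auto simp: rA_rB_dB_def)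
    also have "\<dots> \<le> b * q + (1 + b') * 1 * q"
      using h \<open>q \<ge> 0\<close> \<open>b' \<ge> 0\<close> by (intro add_left_mono mult_right_mono mult_left_mono) auto
    finally have nB1: "norm (B (x + v k) v) \<le> (b + 1 + b') * q"
      by (simp add: algebra_simps)
    have eq: "A (x + v k) v \<star> B (x + v k) v - A x v \<star> B x v - (A' x v \<star> B x v + A x v \<star> B' x v)
      = rA \<star> B (x + v k) v + A' x v \<star> dB + A x v \<star> rB"
      unfolding rA_rB_dB_def by (simp add: diff_left diff_right add_left add_right algebra_simps)
    have 1: "norm (rA \<star> B (x + v k) v) \<le> (\<eta> * h * p) * ((b + 1 + b') * q) * K"
      using K[of rA "B (x + v k) v"]
      by (rule order_trans) (intro mult_right_mono mult_mono rA nB1 \<open>K \<ge> 0\<close>;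
         use \<eta> h \<open>p \<ge> 0\<close> in simp)
    have "norm (A' x v \<star> dB) \<le> (a' * h * p) * ((1 + b') * h * q) * K"
      using K[of "A' x v" dB]
      by (rule order_trans) (intro mult_right_mono mult_mono nA' dB \<open>K \<ge> 0\<close>;
         use \<eta> h \<open>p \<ge> 0\<close> \<open>a' \<ge> 0\<close> in simp)
    also have "\<dots> \<le> (a' * h * p) * ((1 + b') * \<eta> * q) * K"
      using \<open>a' \<ge> 0\<close> \<open>b' \<ge> 0\<close> \<open>p \<ge> 0\<close> \<open>q \<ge> 0\<close> \<open>K \<ge> 0\<close> h
      by (intro mult_right_mono mult_left_mono) auto
    finally have 2: "norm (A' x v \<star> dB) \<le> (a' * h * p) * ((1 + b') * \<eta> * q) * K" .
    have 3: "norm (A x v \<star> rB) \<le> (a * p) * (\<eta> * h * q) * K"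
      using K[of "A x v" rB]
      by (rule order_trans) (intro mult_right_mono mult_mono nA rB \<open>K \<ge> 0\<close>;
         use \<eta> h \<open>p \<ge> 0\<close> \<open>a \<ge> 0\<close> in simp)
    have "norm (rA \<star> B (x + v k) v + A' x v \<star> dB + A x v \<star> rB) \<le>
       (\<eta> * h * p) * ((b + 1 + b') * q) * K + (a' * h * p) * ((1 + b') * \<eta> * q) * K +
       (a * p) * (\<eta> * h * q) * K"
      using 1 2 3 by (intro order_trans[OF norm_triangle_ineq] add_mono) auto
    also have "\<dots> = (\<eta> * (L - 1)) * (h * (p * q))"
      by (simp add: L_def algebra_simps)
    also have "\<dots> \<le> \<epsilon> * (h * (p * q))"
      using \<eta> h \<open>p \<ge> 0\<close> \<open>q \<ge> 0\<close> by (intro mult_right_mono) (auto simp: algebra_simps)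
    also have "\<dots> = \<epsilon> * norm (v k) * (\<Prod>i\<in>I \<union> J. norm (v i))"
      using k fin by (simp add: h_p_q_def prod.union_disjoint)
    finally show "norm (A (x + v k) v \<star> B (x + v k) v - A x v \<star> B x v -
        (A' x v \<star> B x v + A x v \<star> B' x v)) \<le> \<epsilon> * norm (v k) * (\<Prod>i\<in>I \<union> J. norm (v i))"
      unfolding eq .
  qed (use \<eta> \<open>d1 > 0\<close> \<open>d2 > 0\<close> in auto)
qed

lemma fam_deriv_diff:
  assumes AB: "fam_deriv I k A A'" "fam_deriv I k B B'"
  shows "fam_deriv I k (\<lambda>x v. A x v - B x v) (\<lambda>x v. A' x v - B' x v)"
  unfolding fam_deriv_def
proof (intro ballI allI impI)
  fix x and \<epsilon> :: real
  assume "x \<in> U" "\<epsilon> > 0"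
  then have "\<epsilon> / 2 > 0"
    by simp
  obtain d1 where "d1 > 0" and d1: "\<And>v. norm (v k) < d1 \<Longrightarrow>
      norm (A (x + v k) v - A x v - A' x v) \<le> \<epsilon> / 2 * norm (v k) * (\<Prod>i\<in>I. norm (v i))"
    using AB(1) \<open>x \<in> U\<close> \<open>\<epsilon> / 2 > 0\<close> unfolding fam_deriv_def by meson
  obtain d2 where "d2 > 0" and d2: "\<And>v. norm (v k) < d2 \<Longrightarrow>
      norm (B (x + v k) v - B x v - B' x v) \<le> \<epsilon> / 2 * norm (v k) * (\<Prod>i\<in>I. norm (v i))"
    using AB(2) \<open>x \<in> U\<close> \<open>\<epsilon> / 2 > 0\<close> unfolding fam_deriv_def by meson
  show "\<exists>\<delta>>0. \<forall>v. norm (v k) < \<delta> \<longrightarrow>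
     norm (A (x + v k) v - B (x + v k) v - (A x v - B x v) - (A' x v - B' x v))
       \<le> \<epsilon> * norm (v k) * (\<Prod>i\<in>I. norm (v i))"
  proof (intro exI[of _ "min d1 d2"] conjI allI impI)
    fix v :: "nat \<Rightarrow> 'a"
    assume "norm (v k) < min d1 d2"
    then have "norm ((A (x + v k) v - A x v - A' x v) - (B (x + v k) v - B x v - B' x v)) \<le>
      \<epsilon> / 2 * norm (v k) * (\<Prod>i\<in>I. norm (v i)) + \<epsilon> / 2 * norm (v k) * (\<Prod>i\<in>I. norm (v i))"
      by (intro order_trans[OF norm_triangle_ineq4] add_mono d1 d2) auto
    then show "norm (A (x + v k) v - B (x + v k) v - (A x v - B x v) - (A' x v - B' x v))
       \<le> \<epsilon> * norm (v k) * (\<Prod>i\<in>I. norm (v i))"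
      by (simp add: algebra_simps)
  qed (use \<open>d1 > 0\<close> \<open>d2 > 0\<close> in auto)
qed

text \<open>Only \<open>sol\<close> uses the differential equation, which turns \<open>g\<close>
  into a polynomial in \<open>g\<close> and the new slot. Arguments are constant in \<open>x\<close>
  and products obey the Leibniz rule, so the first derivative of \<open>g\<close> yields all the
  others.\<close>

lemma fam_deriv_exists:
  "fam I A \<Longrightarrow> k \<notin> I \<Longrightarrow> \<exists>A'. fam (insert k I) A' \<and> fam_deriv I k A A'"
proof (induction rule: fam.induct)
  case sol
  let ?A = "\<lambda>x v. v k - g x \<star> v k - (v k \<star> g x - (g x \<star> v k) \<star> g x)"
  have "fam {k} (\<lambda>x v. v k)" "fam {} (\<lambda>x v. g x)"
    by (rule fam.intros)+
  then have "fam ({} \<union> {k}) (\<lambda>x v. g x \<star> v k)" "fam ({k} \<union> {}) (\<lambda>x v. v k \<star> g x)"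
      "fam (({} \<union> {k}) \<union> {}) (\<lambda>x v. (g x \<star> v k) \<star> g x)"
    by (intro fam.mult; simp)+
  then have "fam {k} ?A"
    by (intro fam.diff fam.arg) simp_all
  moreover have "fam_deriv {} k (\<lambda>x v. g x) ?A"
    unfolding fam_deriv_def
  proof (intro ballI allI impI)
    fix x and \<epsilon> :: real
    assume "x \<in> U" "\<epsilon> > 0"
    obtain d where "d > 0" and d: "\<And>y. norm (y - x) < d \<Longrightarrow> norm (g y - g x -
        ((y - x) - g x \<star> (y - x) - ((y - x) \<star> g x - (g x \<star> (y - x)) \<star> g x))) \<le> \<epsilon> * norm (y - x)"
      using ode[OF \<open>x \<in> U\<close>] \<open>\<epsilon> > 0\<close> unfolding has_derivative_at_alt by meson
    show "\<exists>\<delta>>0. \<forall>v. norm (v k) < \<delta> \<longrightarrow>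
      norm (g (x + v k) - g x - (v k - g x \<star> v k - (v k \<star> g x - (g x \<star> v k) \<star> g x))) \<le>
        \<epsilon> * norm (v k) * (\<Prod>i\<in>{}. norm (v i))"
      using \<open>d > 0\<close> d[of "x + v k" for v] by (intro exI[of _ d]) simp
  qed
  ultimately show ?case
    by blast
next
  case (arg i)
  then show ?case
    by (intro exI[of _ "\<lambda>x v. 0"]) (auto simp: fam_deriv_def intro!: fam.zero exI[of _ 1])
next
  case (zero I)
  then show ?case
    by (intro exI[of _ "\<lambda>x v. 0"]) (auto simp: fam_deriv_def intro!: fam.zero exI[of _ 1] mult_nonneg_nonneg prod_nonneg)
next
  case (diff I A B)
  then show ?case
    by (blast intro: fam.diff fam_deriv_diff)
next
  case (mult I A J B)
  then have k: "k \<notin> I" "k \<notin> J"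
    by auto
  then obtain A' B' where *: "fam (insert k I) A'" "fam_deriv I k A A'"
      "fam (insert k J) B'" "fam_deriv J k B B'"
    using mult.IH by blast
  have "fam (insert k I \<union> J) (\<lambda>x v. A' x v \<star> B x v)" "fam (I \<union> insert k J) (\<lambda>x v. A x v \<star> B' x v)"
    by (intro fam.mult * mult.hyps; use k mult.hyps in auto)+
  then have "fam (insert k (I \<union> J)) (\<lambda>x v. A' x v \<star> B x v + A x v \<star> B' x v)"
    by (intro fam_add) simp_all
  with fam_deriv_mult[OF mult.hyps(1,2) *(1,3) mult.hyps(3) k *(2,4)] show ?case
    by blast
qed

lemma prod_list_norm_rev: "(\<Prod>v\<leftarrow>vs. norm v) = (\<Prod>i<length vs. norm (rev vs ! i))"
proof -
  have "(\<Prod>v\<leftarrow>vs. norm v) = prod_list (map norm (rev vs))"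
    by (simp add: rev_map[symmetric] prod_list.rev)
  also have "\<dots> = (\<Prod>i<length vs. norm (rev vs ! i))"
    by (simp add: prod.list_conv_set_nth atLeast0LessThan)
  finally show ?thesis .
qed

text \<open>
  Differentiating prepends an argument to the list, so arguments are numbered from the end of the
  list: the positions of the old arguments do not change, and the new one receives a fresh number.
\<close>

lemma smooth_on_solution: "smooth_on U g"
proof (rule smooth_onI_derivative_class[of
       "\<lambda>n B. \<exists>A. fam {..<n} A \<and> B = (\<lambda>x vs. A x (nth (rev vs)))" "\<lambda>x vs. g x"])
  show "\<exists>A. fam {..<0} A \<and> (\<lambda>x vs. g x) = (\<lambda>x vs. A x (nth (rev vs)))"
    using fam.sol by auto
next
  fix n B x
  assume "\<exists>A. fam {..<n} A \<and> B = (\<lambda>x vs. A x (nth (rev vs)))"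
  then obtain A where A: "fam {..<n} A" "B = (\<lambda>x vs. A x (nth (rev vs)))"
    by blast
  obtain C where C: "\<And>v. norm (A x v) \<le> C * (\<Prod>i<n. norm (v i))"
    using fam_bounded[OF A(1)] by blast
  show "bounded_multilinear n (B x)"
    unfolding bounded_multilinear_def
  proof (intro conjI allI impI exI[of _ C])
    fix us ws :: "'a list"
    assume n: "Suc (length us + length ws) = n"
    \<comment> \<open>In the reversed list \<open>v\<close> sits at index \<open>length ws\<close>;
      the \<open>0\<close> there is a placeholder that the update overwrites.\<close>
    have "A x (nth (rev (us @ v # ws))) = A x ((nth (rev (us @ 0 # ws)))(length ws := v))" for v
      using n by (intro fam_cong_args[OF A(1)]) (auto simp: nth_append nth_Cons')
    moreover have "linear (\<lambda>v. A x ((nth (rev (us @ 0 # ws)))(length ws := v)))"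
      using n by (intro fam_linear[OF A(1)]) auto
    ultimately show "linear (\<lambda>v. B x (us @ v # ws))"
      unfolding A(2) by presburger
  next
    fix vs :: "'a list"
    assume "length vs = n"
    then show "norm (B x vs) \<le> C * (\<Prod>v\<leftarrow>vs. norm v)"
      using C by (simp add: A(2) prod_list_norm_rev)
  qed
next
  fix n B
  assume "\<exists>A. fam {..<n} A \<and> B = (\<lambda>x vs. A x (nth (rev vs)))"
  then obtain A where A: "fam {..<n} A" "B = (\<lambda>x vs. A x (nth (rev vs)))"
    by blast
  obtain A' where A': "fam (insert n {..<n}) A'" "fam_deriv {..<n} n A A'"
    using fam_deriv_exists[OF A(1), of n] by auto
  show "\<exists>B'. (\<exists>A. fam {..<Suc n} A \<and> B' = (\<lambda>x vs. A x (nth (rev vs)))) \<and>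
    (\<forall>x\<in>U. has_multilinear_derivative n B (B' x) x)"
  proof (intro exI[of _ "\<lambda>x vs. A' x (nth (rev vs))"] exI[of _ A'] conjI ballI)
    show "fam {..<Suc n} A'"
      using A'(1) by (simp add: lessThan_Suc)
    fix x assume "x \<in> U"
    show "has_multilinear_derivative n B (\<lambda>vs. A' x (nth (rev vs))) x"
      unfolding has_multilinear_derivative_def
    proof (intro allI impI)
      fix \<epsilon> :: real
      assume "\<epsilon> > 0"
      then obtain d where "d > 0" and d: "\<And>v. norm (v n) < d \<Longrightarrow>
        norm (A (x + v n) v - A x v - A' x v) \<le> \<epsilon> * norm (v n) * (\<Prod>i<n. norm (v i))"
        using A'(2) \<open>x \<in> U\<close> unfolding fam_deriv_def by meson
      show "\<exists>\<delta>>0. \<forall>h. norm h < \<delta> \<longrightarrow> (\<forall>vs. length vs = n \<longrightarrow>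
        norm (B (x + h) vs - B x vs - A' x (nth (rev (h # vs)))) \<le> \<epsilon> * norm h * (\<Prod>v\<leftarrow>vs. norm v))"
      proof (intro exI[of _ d] conjI allI impI)
        fix h :: 'a and vs :: "'a list"
        assume "norm h < d" and vs: "length vs = n"
        define v where "v = nth (rev (h # vs))"
        have vn: "v n = h"
          using vs by (simp add: v_def nth_append)
        have v: "v i = rev vs ! i" if "i < n" for i
          using vs that by (simp add: v_def nth_append)
        have "A y v = B y vs" for y
          unfolding A(2) using v by (intro fam_cong_args[OF A(1)]) auto
        moreover have "(\<Prod>i<n. norm (v i)) = (\<Prod>v\<leftarrow>vs. norm v)"
          using v vs by (simp add: prod_list_norm_rev)
        ultimately show "norm (B (x + h) vs - B x vs - A' x (nth (rev (h # vs)))) \<le>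
            \<epsilon> * norm h * (\<Prod>v\<leftarrow>vs. norm v)"
          using d[of v] \<open>norm h < d\<close> unfolding v_def[symmetric] by (simp add: vn)
      qed (fact \<open>d > 0\<close>)
    qed
  qed simp
qed simp

end

section \<open>Quasi-inverses\<close>

text \<open>With a unit adjoined, the equations say that \<open>1 - g\<close> is the inverse of
  \<open>1 + h\<close>, so \<open>g = h (1 + h)^-1\<close>.\<close>

definition quasi_inverse :: "('a \<Rightarrow> 'a \<Rightarrow> 'a) \<Rightarrow> 'a::ab_group_add \<Rightarrow> 'a \<Rightarrow> bool" where
  "quasi_inverse m h g \<longleftrightarrow> m h g = h - g \<and> m g h = h - g"

definition quasi :: "('a \<Rightarrow> 'a \<Rightarrow> 'a) \<Rightarrow> 'a::ab_group_add \<Rightarrow> 'a" where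
  "quasi m h = (THE g. quasi_inverse m h g)"

definition quasi_regular :: "('a \<Rightarrow> 'a \<Rightarrow> 'a) \<Rightarrow> 'a::ab_group_add set" where
  "quasi_regular m = {h. \<exists>g. quasi_inverse m h g}"

locale banach_multiplication = bounded_bilinear mult
  for mult :: "'a::banach \<Rightarrow> 'a \<Rightarrow> 'a"  (infixl "\<star>" 70) +
  assumes assoc: "(a \<star> b) \<star> c = a \<star> (b \<star> c)"
begin

text \<open>Associativity identifies a right with a left quasi-inverse. The one-sided form serves
  \<open>small_quasi_regular\<close>, where the two are found separately.\<close>

lemma quasi_inverse_unique:
  assumes "h \<star> g = h - g" "g' \<star> h = h - g'"
  shows "g = g'"
proof -
  have "(g' \<star> h) \<star> g = g' \<star> (h \<star> g)"
    by (rule assoc)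
  then show ?thesis
    using assms by (simp add: diff_left diff_right)
qed

lemma quasi_eq: "quasi_inverse (\<star>) h g \<Longrightarrow> quasi (\<star>) h = g"
  unfolding quasi_def quasi_inverse_def using quasi_inverse_unique by blast

lemma quasi_inverse_quasi: "h \<in> quasi_regular (\<star>) \<Longrightarrow> quasi_inverse (\<star>) h (quasi (\<star>) h)"
  using quasi_eq by (auto simp: quasi_regular_def)

lemma quasi_inverse_0: "quasi_inverse (\<star>) 0 0"
  by (simp add: quasi_inverse_def zero_left)

text \<open>For small \<open>h\<close> the maps \<open>x \<mapsto> h - h \<star> x\<close> and
  \<open>x \<mapsto> h - x \<star> h\<close> are contractions with factor \<open>norm h * K\<close>;
  their fixed points are the one-sided quasi-inverses.\<close>

lemma small_quasi_regular: "\<exists>r>0. ball 0 r \<subseteq> quasi_regular (\<star>)"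
proof -
  obtain K where "K > 0" and K: "\<And>a b. norm (a \<star> b) \<le> norm a * norm b * K"
    using pos_bounded by blast
  have "h \<in> quasi_regular (\<star>)" if "norm h < inverse K" for h
  proof -
    have c: "0 \<le> norm h * K" "norm h * K < 1"
      using that \<open>K > 0\<close> by (auto simp: field_simps)
    have "dist (h - h \<star> x) (h - h \<star> y) \<le> norm h * K * dist x y" for x y
      using K[of h "x - y"] by (simp add: dist_norm diff_right norm_minus_commute mult.commute mult.left_commute)
    then obtain g where g: "h - h \<star> g = g"
      using banach_fix_type[OF c, of "\<lambda>x. h - h \<star> x"] by blast
    have "dist (h - x \<star> h) (h - y \<star> h) \<le> norm h * K * dist x y" for x y
      using K[of "x - y" h] by (simp add: dist_norm diff_left norm_minus_commute mult.commute mult.left_commute)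
    then obtain g' where g': "h - g' \<star> h = g'"
      using banach_fix_type[OF c, of "\<lambda>x. h - x \<star> h"] by blast
    have *: "h \<star> g = h - g" "g' \<star> h = h - g'"
      using g g' by (metis diff_diff_eq2 add_diff_cancel_left')+
    then have "g = g'"
      by (rule quasi_inverse_unique)
    with * show ?thesis
      by (auto simp: quasi_regular_def quasi_inverse_def)
  qed
  then show ?thesis
    using \<open>K > 0\<close> by (intro exI[of _ "inverse K"]) auto
qed

text \<open>
  With \<open>circ a b = a + b + a \<star> b\<close>, which is the product of \<open>1 + a\<close> and \<open>1 + b\<close> minus \<open>1\<close>,
  \<open>g\<close> is a quasi-inverse of \<open>h\<close> iff \<open>- g\<close> is inverse to \<open>h\<close> in the monoid of \<open>circ\<close>.
\<close>

definition circ :: "'a \<Rightarrow> 'a \<Rightarrow> 'a" where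
  "circ a b = a + b + a \<star> b"

lemma circ_assoc: "circ (circ a b) c = circ a (circ b c)"
  by (simp add: circ_def add_left add_right assoc algebra_simps)

lemma circ_0: "circ a 0 = a" "circ 0 a = a"
  by (simp_all add: circ_def zero_left zero_right)

lemma quasi_inverse_circ:
  "quasi_inverse (\<star>) h g \<longleftrightarrow> circ h (- g) = 0 \<and> circ (- g) h = 0"
  by (auto simp: quasi_inverse_def circ_def minus_left minus_right algebra_simps)

text \<open>Translation by the inverse \<open>- g0\<close> in the monoid of \<open>circ\<close>
  carries points near \<open>h0\<close> to points near \<open>0\<close>, where quasi-inverses exist.
  The inverse of \<open>h\<close> is then assembled from two factors.\<close>

lemma open_quasi_regular: "open (quasi_regular (\<star>))"
proof (subst open_contains_ball, intro ballI)
  fix h0 assume "h0 \<in> quasi_regular (\<star>)"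
  then obtain g0 where g0: "circ h0 (- g0) = 0" "circ (- g0) h0 = 0"
    by (auto simp: quasi_regular_def quasi_inverse_circ)
  obtain r where "r > 0" and r: "ball 0 r \<subseteq> quasi_regular (\<star>)"
    using small_quasi_regular by blast
  have "isCont (\<lambda>h. circ (- g0) h) h0"
    unfolding circ_def by (intro continuous_intros isCont)
  then obtain d where "d > 0" and d: "\<And>h. dist h h0 < d \<Longrightarrow> dist (circ (- g0) h) (circ (- g0) h0) < r"
    using \<open>r > 0\<close> unfolding continuous_at_eps_delta by (metis dist_norm)
  have "ball h0 d \<subseteq> quasi_regular (\<star>)"
  proof
    fix h assume "h \<in> ball h0 d"
    then have "circ (- g0) h \<in> ball 0 r"
      using d[of h] g0 by (simp add: dist_commute)
    then obtain w where w: "circ (circ (- g0) h) (- w) = 0" "circ (- w) (circ (- g0) h) = 0"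
      using r by (auto simp: quasi_regular_def quasi_inverse_circ)
    have h: "h = circ h0 (circ (- g0) h)"
      by (simp add: circ_assoc[symmetric] g0 circ_0)
    define k where "k = circ (- w) (- g0)"
    have "circ k h = 0"
      using w by (simp add: k_def circ_assoc)
    moreover have "circ h k = circ (circ h0 (circ (circ (- g0) h) (- w))) (- g0)"
      unfolding k_def by (subst h) (simp only: circ_assoc)
    then have "circ h k = 0"
      by (simp add: w circ_0 g0)
    ultimately have "quasi_inverse (\<star>) h (- k)"
      by (simp add: quasi_inverse_circ)
    then show "h \<in> quasi_regular (\<star>)"
      by (auto simp: quasi_regular_def)
  qed
  with \<open>d > 0\<close> show "\<exists>d>0. ball h0 d \<subseteq> quasi_regular (\<star>)"
    by blast
qed

text \<open>This is the resolvent identity \<open>g1 - g0 = (1 - g1) v (1 - g0)\<close>, written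
  without a unit. Being exact, it yields both the Lipschitz bound and the derivative below.\<close>

lemma quasi_difference:
  assumes "quasi_inverse (\<star>) h0 g0" "quasi_inverse (\<star>) (h0 + v) g1"
  shows "g1 - g0 = (v - v \<star> g0) - g1 \<star> (v - v \<star> g0)"
proof -
  have 0: "h0 \<star> g0 = h0 - g0"
    using assms(1) by (simp add: quasi_inverse_def)
  have 1: "g1 \<star> h0 + g1 \<star> v = h0 + v - g1"
    using assms(2) by (simp add: quasi_inverse_def add_right)
  have "(g1 \<star> h0 + g1 \<star> v) \<star> g0 = (h0 + v - g1) \<star> g0"
    by (simp only: 1)
  then have 2: "g1 \<star> (v \<star> g0) = h0 - g0 + v \<star> g0 - g1 \<star> g0 - g1 \<star> (h0 - g0)"
    by (simp add: add_left diff_left assoc 0 algebra_simps)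
  show ?thesis
    using 1 by (simp add: diff_right 2 algebra_simps)
qed

lemma has_derivative_quasi:
  assumes "h0 \<in> quasi_regular (\<star>)"
  defines "g0 \<equiv> quasi (\<star>) h0"
  shows "(quasi (\<star>) has_derivative (\<lambda>v. v - g0 \<star> v - (v \<star> g0 - (g0 \<star> v) \<star> g0))) (at h0)"
  unfolding has_derivative_at_alt
proof (intro conjI allI impI)
  show "bounded_linear (\<lambda>v. v - g0 \<star> v - (v \<star> g0 - (g0 \<star> v) \<star> g0))"
    by (intro bounded_linear_sub bounded_linear_ident bounded_linear_left bounded_linear_right
        bounded_linear_compose[OF bounded_linear_left bounded_linear_right])
next
  fix \<epsilon> :: real
  assume "\<epsilon> > 0"
  obtain K where "K > 0" and K: "\<And>a b. norm (a \<star> b) \<le> norm a * norm b * K"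
    using pos_bounded by blast
  obtain r where "r > 0" and r: "ball h0 r \<subseteq> quasi_regular (\<star>)"
    using open_quasi_regular assms(1) open_contains_ball by blast
  define c where "c = 1 + norm g0 * K"
  have "c \<ge> 1"
    using \<open>K > 0\<close> by (simp add: c_def)
  \<comment> \<open>\<open>c\<close> bounds multiplication by \<open>1 - g0\<close>. The bound
    \<open>1 / (2 * c * K)\<close> gives \<open>norm e * K \<le> 1 / 2\<close>, needed for
    absorption; the last bound makes the final error
    \<open>(2 * c ^ 2 * norm v) * (c * norm v) * K\<close> at most
    \<open>\<epsilon> * norm v\<close>.\<close>
  define d where "d = min r (min (1 / (2 * c * K)) (\<epsilon> / (2 * c ^ 3 * K)))"
  have "d > 0"
    using \<open>r > 0\<close> \<open>K > 0\<close> \<open>c \<ge> 1\<close> \<open>\<epsilon> > 0\<close> by (simp add: d_def)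
  show "\<exists>d>0. \<forall>y. norm (y - h0) < d \<longrightarrow> norm (quasi (\<star>) y - quasi (\<star>) h0 -
      ((y - h0) - g0 \<star> (y - h0) - ((y - h0) \<star> g0 - (g0 \<star> (y - h0)) \<star> g0))) \<le> \<epsilon> * norm (y - h0)"
  proof (intro exI[of _ d] conjI allI impI \<open>d > 0\<close>)
    fix h assume h: "norm (h - h0) < d"
    define v e g1 where "v = h - h0" "e = v - v \<star> g0" "g1 = quasi (\<star>) h"
    have v: "norm v < r" "norm v * (c * K) \<le> 1 / 2" "norm v * (2 * c ^ 3 * K) \<le> \<epsilon>"
      using h \<open>K > 0\<close> \<open>c \<ge> 1\<close> by (auto simp: d_def v_e_g1_def field_simps)
    have "h \<in> quasi_regular (\<star>)"
      using r v(1) by (auto simp: subset_iff dist_norm norm_minus_commute v_e_g1_def)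
    then have "quasi_inverse (\<star>) (h0 + v) g1" "quasi_inverse (\<star>) h0 g0"
      using quasi_inverse_quasi assms by (auto simp: v_e_g1_def)
    then have diff: "g1 - g0 = e - g1 \<star> e"
      unfolding v_e_g1_def by (intro quasi_difference)
    have "norm e \<le> norm v + norm (v \<star> g0)"
      unfolding v_e_g1_def by (rule norm_triangle_ineq4)
    then have e: "norm e \<le> c * norm v"
      using K[of v g0] by (simp add: c_def algebra_simps)
    have "g1 - g0 = e - g0 \<star> e - (g1 - g0) \<star> e"
      by (subst diff) (simp add: diff_left)
    then have "norm (g1 - g0) \<le> norm e + norm (g0 \<star> e) + norm ((g1 - g0) \<star> e)"
      by (metis (no_types) add_mono_thms_linordered_semiring(3) norm_triangle_ineq4 order_trans)
    also have "\<dots> \<le> norm e + norm g0 * norm e * K + norm (g1 - g0) * norm e * K"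
      by (intro add_mono K order_refl)
    also have "\<dots> = c * norm e + norm (g1 - g0) * K * norm e"
      by (simp add: c_def algebra_simps)
    also have "\<dots> \<le> c * (c * norm v) + norm (g1 - g0) * K * (c * norm v)"
      using \<open>c \<ge> 1\<close> \<open>K > 0\<close> by (intro add_mono mult_left_mono e) auto
    \<comment> \<open>The unknown \<open>norm (g1 - g0)\<close> recurs with factor
      \<open>1 / 2\<close> and is absorbed on the left, so no continuity of the quasi-inverse is
      presupposed.\<close>
    also have "norm (g1 - g0) * K * (c * norm v) \<le> norm (g1 - g0) * (1 / 2)"
      using mult_left_mono[OF v(2) norm_ge_zero[of "g1 - g0"]] by (simp add: ac_simps)
    finally have d: "norm (g1 - g0) \<le> 2 * c ^ 2 * norm v"
      by (simp add: power2_eq_square)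
    have "g1 - g0 - (v - g0 \<star> v - (v \<star> g0 - (g0 \<star> v) \<star> g0)) = - ((g1 - g0) \<star> e)"
      by (subst diff) (simp add: v_e_g1_def diff_left diff_right assoc)
    then have "norm (g1 - g0 - (v - g0 \<star> v - (v \<star> g0 - (g0 \<star> v) \<star> g0))) = norm ((g1 - g0) \<star> e)"
      by simp
    also have "\<dots> \<le> norm (g1 - g0) * norm e * K"
      by (rule K)
    also have "\<dots> \<le> (2 * c ^ 2 * norm v) * (c * norm v) * K"
      using d e \<open>K > 0\<close> \<open>c \<ge> 1\<close> by (intro mult_right_mono mult_mono) auto
    also have "\<dots> = (norm v * (2 * c ^ 3 * K)) * norm v"
      by (simp add: power2_eq_square power3_eq_cube)
    also have "\<dots> \<le> \<epsilon> * norm v"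
      using v(3) by (intro mult_right_mono) auto
    finally show "norm (quasi (\<star>) h - quasi (\<star>) h0 -
        ((h - h0) - g0 \<star> (h - h0) - ((h - h0) \<star> g0 - (g0 \<star> (h - h0)) \<star> g0))) \<le> \<epsilon> * norm (h - h0)"
      by (simp add: v_e_g1_def g0_def)
  qed
qed

lemma smooth_on_quasi: "smooth_on (quasi_regular (\<star>)) (quasi (\<star>))"
proof -
  interpret quadratic_ode mult "quasi_regular (\<star>)" "quasi (\<star>)"
    by unfold_locales (rule has_derivative_quasi)
  show ?thesis
    by (rule smooth_on_solution)
qed

end

section \<open>Operators from one space to another under the product \<open>Y A Z\<close>\<close>

definition sandwich ::
  "('b::real_normed_vector \<Rightarrow>\<^sub>L 'a::real_normed_vector) \<Rightarrow> ('a \<Rightarrow>\<^sub>L 'b) \<Rightarrow> ('a \<Rightarrow>\<^sub>L 'b) \<Rightarrow> ('a \<Rightarrow>\<^sub>L 'b)" where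
  "sandwich A Y Z = Y o\<^sub>L A o\<^sub>L Z"

lemma sandwich_apply [simp]: "sandwich A Y Z x = Y (A (Z x))"
  by (simp add: sandwich_def)

lemma banach_multiplication_sandwich:
  fixes A :: "'b::banach \<Rightarrow>\<^sub>L 'a::real_normed_vector"
  shows "banach_multiplication (sandwich A)"
proof (intro banach_multiplication.intro banach_multiplication_axioms.intro)
  show "bounded_bilinear (sandwich A)"
    unfolding sandwich_def
    by (intro bounded_bilinear.comp1[OF bounded_bilinear_blinfun_compose]
        bounded_linear_intros)
qed (auto intro: blinfun_eqI)

text \<open>Negating \<open>A\<close> exchanges the roles of \<open>g\<close> and \<open>h\<close>.
  Hence the inverse chart is again a quasi-inverse map, and its smoothness is the same
  statement.\<close>

lemma quasi_inverse_sandwich_uminus: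
  "quasi_inverse (sandwich (- A)) g h \<longleftrightarrow> quasi_inverse (sandwich A) h g"
proof -
  have "sandwich (- A) Y Z = - sandwich A Y Z" for Y Z
    by (intro blinfun_eqI) (simp add: blinfun.bilinear_simps)
  then show ?thesis
    by (auto simp: quasi_inverse_def neg_eq_iff_add_eq_0 minus_equation_iff algebra_simps)
qed

section \<open>The Hahn-Banach and open mapping theorems\<close>

definition sublinear :: "('a::real_vector \<Rightarrow> real) \<Rightarrow> bool" where
  "sublinear p \<longleftrightarrow> (\<forall>x y. p (x + y) \<le> p x + p y) \<and> (\<forall>x. \<forall>t>0. p (t *\<^sub>R x) \<le> t * p x)"

lemma sublinear_0:
  assumes "sublinear p"
  shows "p 0 = 0"
proof -
  have "p (0 + 0) \<le> p 0 + p 0" "p ((1 / 2 :: real) *\<^sub>R 0) \<le> 1 / 2 * p 0"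
    using assms unfolding sublinear_def by (blast, meson half_gt_zero zero_less_one)
  then show ?thesis
    by simp
qed

lemma sublinear_scale:
  assumes "sublinear p" "t \<ge> 0"
  shows "p (t *\<^sub>R x) = t * p x"
proof (cases "t = 0")
  case True
  then show ?thesis
    by (simp add: sublinear_0[OF assms(1)])
next
  case False
  with assms have "t > 0"
    by simp
  then have "p (inverse t *\<^sub>R (t *\<^sub>R x)) \<le> inverse t * p (t *\<^sub>R x)"
    using assms(1) unfolding sublinear_def by (meson positive_imp_inverse_positive)
  with \<open>t > 0\<close> have "t * p x \<le> p (t *\<^sub>R x)"
    by (simp add: field_simps)
  moreover have "p (t *\<^sub>R x) \<le> t * p x"
    using assms(1) \<open>t > 0\<close> unfolding sublinear_def by blast
  ultimately show ?thesis
    by simp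
qed

lemma sublinear_minus:
  assumes "sublinear p"
  shows "- p (- x) \<le> p x"
proof -
  have "p (x + - x) \<le> p x + p (- x)"
    using assms unfolding sublinear_def by blast
  then show ?thesis
    by (simp add: sublinear_0[OF assms])
qed

text \<open>The functional is the infimum over \<open>t \<ge> 0\<close> of
  \<open>p (x + t y) - t p y\<close>, finite because \<open>- p (- x)\<close> is a lower bound. The
  choices \<open>t = 0\<close> and \<open>t = 1\<close> give the two inequalities. It makes minimal
  functionals odd and also steers a functional in a chosen direction.\<close>

lemma sublinear_descent:
  assumes p: "sublinear p"
  obtains q where "sublinear q" "q \<le> p" "q (- y) \<le> - p y"
proof -
  define v where "v x t = p (x + t *\<^sub>R y) - t * p y" for x t
  define q where "q x = (INF t\<in>{0..}. v x t)" for x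
  have bdd: "bdd_below (v x ` {0..})" for x
  proof (intro bdd_belowI2)
    fix t :: real assume "t \<in> {0..}"
    then have "t * p y = p (t *\<^sub>R y)"
      by (simp add: sublinear_scale[OF p])
    also have "\<dots> = p ((x + t *\<^sub>R y) + - x)"
      by simp
    also have "\<dots> \<le> p (x + t *\<^sub>R y) + p (- x)"
      using p unfolding sublinear_def by blast
    finally show "- p (- x) \<le> v x t"
      by (simp add: v_def)
  qed
  have q_le: "q x \<le> v x t" if "t \<ge> 0" for x t
    unfolding q_def using that by (intro cINF_lower bdd) auto
  have le_q: "c \<le> q x" if "\<And>t. t \<ge> 0 \<Longrightarrow> c \<le> v x t" for c x
    unfolding q_def using that by (intro cINF_greatest) auto
  have "sublinear q"
    unfolding sublinear_def
  proof (intro conjI allI impI)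
    fix x z
    have "q (x + z) \<le> v x t + v z s" if "t \<ge> 0" "s \<ge> 0" for t s
    proof -
      have "q (x + z) \<le> v (x + z) (t + s)"
        using that by (intro q_le) auto
      also have "p ((x + t *\<^sub>R y) + (z + s *\<^sub>R y)) \<le> p (x + t *\<^sub>R y) + p (z + s *\<^sub>R y)"
        using p unfolding sublinear_def by blast
      then have "v (x + z) (t + s) \<le> v x t + v z s"
        by (simp add: v_def algebra_simps)
      finally show ?thesis .
    qed
    then have "q (x + z) - v z s \<le> q x" if "s \<ge> 0" for s
      using that by (intro le_q) (simp add: algebra_simps)
    then have "q (x + z) - q x \<le> q z"
      by (intro le_q) (simp add: algebra_simps)
    then show "q (x + z) \<le> q x + q z"
      by simp
  next
    fix x and s :: real
    assume "s > 0"
    have "q (s *\<^sub>R x) / s \<le> v x t" if "t \<ge> 0" for t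
    proof -
      have "q (s *\<^sub>R x) \<le> v (s *\<^sub>R x) (s * t)"
        using that \<open>s > 0\<close> by (intro q_le) simp
      also have "\<dots> = p (s *\<^sub>R (x + t *\<^sub>R y)) - s * t * p y"
        by (simp add: v_def algebra_simps)
      also have "\<dots> = s * v x t"
        using \<open>s > 0\<close> by (subst sublinear_scale[OF p]) (auto simp: v_def algebra_simps)
      finally show ?thesis
        using \<open>s > 0\<close> by (simp add: field_simps)
    qed
    then have "q (s *\<^sub>R x) / s \<le> q x"
      by (rule le_q)
    with \<open>s > 0\<close> show "q (s *\<^sub>R x) \<le> s * q x"
      by (simp add: field_simps)
  qed
  moreover have "q \<le> p"
    using q_le[of 0] by (auto simp: le_fun_def v_def)
  moreover have "q (- y) \<le> - p y"
    using q_le[of 1 "- y"] by (simp add: v_def sublinear_0[OF p])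
  ultimately show thesis
    by (rule that)
qed

lemma minimal_sublinear_linear:
  assumes p: "sublinear p" and min: "\<And>q. sublinear q \<Longrightarrow> q \<le> p \<Longrightarrow> q = p"
  shows "linear p"
proof -
  have neg: "p (- y) \<le> - p y" for y
    using sublinear_descent[OF p, of y] min by metis
  have add: "p (x + y) = p x + p y" for x y
  proof (rule antisym)
    show "p (x + y) \<le> p x + p y"
      using p unfolding sublinear_def by blast
    have "p ((x + y) + - y) \<le> p (x + y) + p (- y)"
      using p unfolding sublinear_def by blast
    then show "p x + p y \<le> p (x + y)"
      using neg[of y] by simp
  qed
  have minus: "p (- x) = - p x" for x
    using add[of x "- x"] sublinear_0[OF p] by simp
  show ?thesis
  proof (intro linearI add)
    fix t x
    show "p (t *\<^sub>R x) = t *\<^sub>R p x"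
    proof (cases "t \<ge> 0")
      case True
      then show ?thesis
        by (simp add: sublinear_scale[OF p])
    next
      case False
      then have "p ((- t) *\<^sub>R x) = (- t) * p x"
        by (intro sublinear_scale[OF p]) simp
      then show ?thesis
        by (simp add: minus)
    qed
  qed
qed

text \<open>A minimal sublinear functional below \<open>p\<close> is linear; Zorn's lemma provides
  one, with pointwise infima as lower bounds of chains. A prescribed value is not part of this form:
  it is built into the majorant beforehand.\<close>

theorem Hahn_Banach_sublinear:
  fixes p :: "'a::real_vector \<Rightarrow> real"
  assumes p: "sublinear p"
  obtains f where "linear f" "f \<le> p"
proof -
  define A where "A = {q. sublinear q \<and> q \<le> p}"
  have "\<exists>m\<in>A. \<forall>a\<in>A. m \<ge> a \<longrightarrow> a = m"
  proof (rule predicate_Zorn)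
    show "partial_order_on A (relation_of (\<ge>) A)"
      by (rule partial_order_on_relation_ofI) auto
  next
    fix C assume C: "C \<in> Chains (relation_of (\<ge>) A)"
    then have CA: "C \<subseteq> A" and total: "\<And>a b. a \<in> C \<Longrightarrow> b \<in> C \<Longrightarrow> a \<le> b \<or> b \<le> a"
      unfolding Chains_def relation_of_def by blast+
    show "\<exists>u\<in>A. \<forall>a\<in>C. u \<le> a"
    proof (cases "C = {}")
      case True
      then show ?thesis
        using p by (auto simp: A_def)
    next
      case False
      define u where "u x = (INF q\<in>C. q x)" for x
      have bdd: "bdd_below ((\<lambda>q. q x) ` C)" for x
      proof (intro bdd_belowI2)
        fix q assume "q \<in> C"
        then have "sublinear q" "q (- x) \<le> p (- x)"
          using CA by (auto simp: A_def le_fun_def)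
        then show "- p (- x) \<le> q x"
          using sublinear_minus[of q x] by simp
      qed
      have u_le: "u x \<le> q x" if "q \<in> C" for x q
        unfolding u_def using that by (intro cINF_lower bdd)
      have le_u: "c \<le> u x" if "\<And>q. q \<in> C \<Longrightarrow> c \<le> q x" for c x
        unfolding u_def using that False by (intro cINF_greatest)
      have sub: "q (x + y) \<le> q x + q y" "t > 0 \<Longrightarrow> q (t *\<^sub>R x) \<le> t * q x" if "q \<in> C" for q x y t
        using that CA by (auto simp: A_def sublinear_def)
      have "sublinear u"
        unfolding sublinear_def
      proof (intro conjI allI impI)
        fix x y
        \<comment> \<open>Members of a chain are comparable, and subadditivity of the smaller one
          suffices.\<close>
        have "u (x + y) \<le> q x + r y" if "q \<in> C" "r \<in> C" for q r
          using total[OF that]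
        proof
          assume "q \<le> r"
          then have "q y \<le> r y"
            by (simp add: le_fun_def)
          then show ?thesis
            using u_le[OF that(1), of "x + y"] sub(1)[OF that(1), of x y] by linarith
        next
          assume "r \<le> q"
          then have "r x \<le> q x"
            by (simp add: le_fun_def)
          then show ?thesis
            using u_le[OF that(2), of "x + y"] sub(1)[OF that(2), of x y] by linarith
        qed
        then have "u (x + y) - r y \<le> u x" if "r \<in> C" for r
          using that by (intro le_u) (simp add: algebra_simps)
        then have "u (x + y) - u x \<le> u y"
          by (intro le_u) (simp add: algebra_simps)
        then show "u (x + y) \<le> u x + u y"
          by simp
      next
        fix x and t :: real
        assume "t > 0"
        have "u (t *\<^sub>R x) / t \<le> u x"
        proof (rule le_u)
          fix q assume "q \<in> C"
          have "u (t *\<^sub>R x) \<le> t * q x"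
            using u_le[OF \<open>q \<in> C\<close>] sub(2)[OF \<open>q \<in> C\<close> \<open>t > 0\<close>] by (rule order_trans)
          then show "u (t *\<^sub>R x) / t \<le> q x"
            using \<open>t > 0\<close> by (simp add: field_simps)
        qed
        with \<open>t > 0\<close> show "u (t *\<^sub>R x) \<le> t * u x"
          by (simp add: field_simps)
      qed
      moreover have "u \<le> q" if "q \<in> C" for q
        using u_le[OF that] by (simp add: le_fun_def)
      moreover obtain q where "q \<in> C" "q \<le> p"
        using False CA by (auto simp: A_def)
      ultimately have "u \<in> A"
        unfolding A_def using order_trans[of u q p] by blast
      with \<open>\<And>q. q \<in> C \<Longrightarrow> u \<le> q\<close> show ?thesis
        by blast
    qed
  qed
  then obtain m where m: "sublinear m" "m \<le> p" "\<And>q. sublinear q \<Longrightarrow> q \<le> p \<Longrightarrow> q \<le> m \<Longrightarrow> q = m"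
    unfolding A_def by blast
  have "linear m"
    using m by (intro minimal_sublinear_linear) (blast dest: order_trans)+
  then show thesis
    using m(2) by (rule that)
qed

text \<open>Descent from the norm in direction \<open>- b\<close> forces
  \<open>f b \<le> - norm b\<close>, which is negative; the final scaling fixes sign and
  size.\<close>

lemma bounded_functional_nonzero:
  fixes b :: "'a::real_normed_vector"
  assumes "b \<noteq> 0"
  obtains f :: "'a \<Rightarrow>\<^sub>L real" where "f b = 1"
proof -
  have "sublinear (norm :: 'a \<Rightarrow> real)"
    by (auto simp: sublinear_def norm_triangle_ineq)
  then obtain q where q: "sublinear q" "q \<le> norm" "q (- (- b)) \<le> - norm (- b)"
    by (rule sublinear_descent)
  obtain f where f: "linear f" "f \<le> q"
    using Hahn_Banach_sublinear[OF q(1)] .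
  have f_le: "f x \<le> norm x" for x
    using f(2) q(2) by (meson le_fun_def order_trans)
  have "\<bar>f x\<bar> \<le> norm x" for x
    using f_le[of x] f_le[of "- x"] by (simp add: linear_neg[OF f(1)])
  then have bl: "bounded_linear f"
    using f(1) by (auto intro!: bounded_linear_intro[of _ 1] simp: linear_add linear_scale)
  have "f b \<le> - norm b"
    using f(2) q(3) by (metis le_fun_def minus_minus norm_minus_cancel order_trans)
  then have "f b \<noteq> 0"
    using assms by auto
  then have "blinfun_apply (inverse (f b) *\<^sub>R Blinfun f) b = 1"
    using bl by (simp add: scaleR_blinfun.rep_eq bounded_linear_Blinfun_apply)
  then show thesis
    by (rule that)
qed

lemma finite_rank_right_inverse:
  fixes X :: "'a::real_normed_vector \<Rightarrow>\<^sub>L 'b::real_normed_vector"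
  assumes "finite B" "B \<subseteq> range X"
  shows "\<exists>A :: 'b \<Rightarrow>\<^sub>L 'a. \<forall>b\<in>B. X (A b) = b"
  using assms
proof (induction rule: finite_induct)
  case (insert b B)
  then obtain A :: "'b \<Rightarrow>\<^sub>L 'a" where A: "\<And>c. c \<in> B \<Longrightarrow> X (A c) = c"
    by auto
  define b' where "b' = b - X (A b)"
  show ?case
  proof (cases "b' = 0")
    case True
    then show ?thesis
      using A by (intro exI[of _ A]) (auto simp: b'_def)
  next
    case False
    then obtain f :: "'b \<Rightarrow>\<^sub>L real" where f: "f b' = 1"
      by (rule bounded_functional_nonzero)
    obtain a where a: "b = X a"
      using insert.prems by auto
    define e where "e = a - A b"
    have e: "X e = b'"
      by (simp add: e_def b'_def a blinfun.diff_right)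
    \<comment> \<open>A rank-one correction: \<open>f\<close> is applied to the part of
      \<open>y\<close> that \<open>A\<close> fails to lift. This part vanishes on \<open>B\<close>,
      and for \<open>b\<close> it is \<open>b'\<close>, whose preimage \<open>e\<close> is
      added.\<close>
    define A' where "A' = A + (blinfun_scaleR_left e o\<^sub>L f o\<^sub>L (id_blinfun - (X o\<^sub>L A)))"
    have A': "A' y = A y + f (y - X (A y)) *\<^sub>R e" for y
      by (simp add: A'_def blinfun.bilinear_simps scaleR_diff_left)
    have "X (A' c) = c" if "c \<in> insert b B" for c
      using that f e A by (auto simp: A' blinfun.bilinear_simps b'_def)
    then show ?thesis
      by blast
  qed
qed simp

section \<open>The open mapping theorem on a closed subspace\<close>

text \<open>The Baire argument is run on a closed subspace \<open>V\<close>, since a product of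
  complements is a set and not a type. The outcome is a choice of preimages with a linear norm
  bound.\<close>

theorem open_mapping_bound:
  fixes f :: "'a::banach \<Rightarrow> 'b::banach"
  assumes f: "bounded_linear f" and V: "closed V" "subspace V" and onto: "f ` V = UNIV"
  obtains C where "\<And>y. \<exists>x\<in>V. f x = y \<and> norm x \<le> C * norm y"
proof -
  interpret f: bounded_linear f
    by (fact f)
  define K where "K n = closure (f ` (V \<inter> cball 0 (real n)))" for n
  have "\<Union> (range K) = UNIV"
  proof (intro set_eqI iffI UNIV_I)
    fix y
    obtain x where "x \<in> V" "f x = y"
      using onto by (metis UNIV_I imageE)
    moreover obtain n where "norm x \<le> real n"
      using real_arch_simple by blast
    ultimately have "y \<in> f ` (V \<inter> cball 0 (real n))"
      by auto
    then have "y \<in> K n"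
      unfolding K_def by (rule subsetD[OF closure_subset])
    then show "y \<in> \<Union> (range K)"
      by blast
  qed
  moreover have "interior (\<Union> (range K)) = {}" if "\<And>n. interior (K n) = {}"
  proof -
    have "euclidean interior_of (\<Union> (range K)) = {}"
      using that by (intro Baire_category_alt)
        (auto simp: completely_metrizable_space_euclidean K_def)
    then show ?thesis
      by simp
  qed
  ultimately obtain n where "interior (K n) \<noteq> {}"
    by force
  then obtain y0 r where "r > 0" and r: "ball y0 r \<subseteq> K n"
    using mem_interior by blast
  have approx: "\<exists>x\<in>V. norm x \<le> 2 * real n \<and> norm (f x - z) < \<epsilon>" if "norm z < r" "\<epsilon> > 0" for z \<epsilon>
  proof -
    have "y0 + z \<in> K n" "y0 \<in> K n"
      using that \<open>r > 0\<close> by (auto intro!: subsetD[OF r] simp: dist_norm)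
    then obtain u1 u2 where u: "u1 \<in> f ` (V \<inter> cball 0 (real n))" "dist u1 (y0 + z) < \<epsilon> / 2"
        "u2 \<in> f ` (V \<inter> cball 0 (real n))" "dist u2 y0 < \<epsilon> / 2"
      using half_gt_zero[OF \<open>\<epsilon> > 0\<close>] unfolding K_def closure_approachable by meson
    then obtain x1 x2 where x: "x1 \<in> V" "norm x1 \<le> real n" "dist (f x1) (y0 + z) < \<epsilon> / 2"
        "x2 \<in> V" "norm x2 \<le> real n" "dist (f x2) y0 < \<epsilon> / 2"
      by auto
    have "norm (x1 - x2) \<le> 2 * real n"
      using x norm_triangle_ineq4[of x1 x2] by simp
    moreover have "norm (f (x1 - x2) - z) < \<epsilon>"
    proof -
      have "f (x1 - x2) - z = (f x1 - (y0 + z)) - (f x2 - y0)"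
        by (simp add: f.diff)
      also have "norm \<dots> \<le> norm (f x1 - (y0 + z)) + norm (f x2 - y0)"
        by (rule norm_triangle_ineq4)
      also have "\<dots> < \<epsilon>"
        using x by (simp add: dist_norm)
      finally show ?thesis .
    qed
    ultimately show ?thesis
      using x V(2) by (meson subspace_diff)
  qed
  \<comment> \<open>A vector \<open>y\<close> is scaled to norm \<open>r / 2\<close>, approximated
    within \<open>r / 4\<close>, half of that, and scaled back by \<open>2 * norm y / r\<close>;
    this factor meets the bound \<open>2 * real n\<close> on preimages.\<close>
  define M where "M = 4 * real n / r"
  have "M \<ge> 0"
    using \<open>r > 0\<close> by (simp add: M_def)
  have "\<exists>x\<in>V. norm x \<le> M * norm y \<and> norm (y - f x) \<le> norm y / 2" for y
  proof (cases "y = 0")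
    case True
    then show ?thesis
      using V(2) by (intro bexI[of _ 0]) (auto simp: subspace_0)
  next
    case False
    define s where "s = r / (2 * norm y)"
    have "s > 0"
      using False \<open>r > 0\<close> by (simp add: s_def)
    have "norm (s *\<^sub>R y) < r" "r / 4 > 0"
      using False \<open>r > 0\<close> by (simp_all add: s_def)
    then obtain x where x: "x \<in> V" "norm x \<le> 2 * real n" "norm (f x - s *\<^sub>R y) < r / 4"
      using approx by blast
    have "norm (inverse s *\<^sub>R x) \<le> M * norm y"
    proof -
      have "norm (inverse s *\<^sub>R x) = norm x / s"
        using \<open>s > 0\<close> by (simp add: divide_inverse_commute)
      also have "\<dots> \<le> 2 * real n / s"
        using x \<open>s > 0\<close> by (intro divide_right_mono) auto
      also have "\<dots> = M * norm y"
        using \<open>r > 0\<close> by (simp add: M_def s_def)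
      finally show ?thesis .
    qed
    moreover have "norm (y - f (inverse s *\<^sub>R x)) \<le> norm y / 2"
    proof -
      have "y - f (inverse s *\<^sub>R x) = inverse s *\<^sub>R (s *\<^sub>R y - f x)"
        using \<open>s > 0\<close> by (simp add: f.scaleR scaleR_diff_right)
      then have "norm (y - f (inverse s *\<^sub>R x)) = norm (f x - s *\<^sub>R y) / s"
        using \<open>s > 0\<close> by (simp add: divide_inverse_commute norm_minus_commute)
      also have "\<dots> \<le> (r / 4) / s"
        using x \<open>s > 0\<close> by (intro divide_right_mono) auto
      also have "\<dots> = norm y / 2"
        using \<open>r > 0\<close> by (simp add: s_def)
      finally show ?thesis .
    qed
    ultimately show ?thesis
      using x(1) V(2) by (meson subspace_scale)
  qed
  then obtain s where s: "\<And>y. s y \<in> V" "\<And>y. norm (s y) \<le> M * norm y"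
      "\<And>y. norm (y - f (s y)) \<le> norm y / 2"
    by metis
  have "\<exists>x\<in>V. f x = y \<and> norm x \<le> 2 * M * norm y" for y
  proof -
    \<comment> \<open>Residuals of successive approximation, at least halved each time. The
      corrections are dominated by a geometric series, whence the constant \<open>2 * M\<close>, and
      closedness of \<open>V\<close> keeps their sum in \<open>V\<close>.\<close>
    define e where "e k = ((\<lambda>z. z - f (s z)) ^^ k) y" for k
    have e_Suc: "e (Suc k) = e k - f (s (e k))" for k
      by (simp add: e_def)
    have e: "norm (e k) \<le> norm y * (1 / 2) ^ k" for k
    proof (induction k)
      case (Suc k)
      then show ?case
        using s(3)[of "e k"] by (simp add: e_Suc)
    qed (simp add: e_def)
    have ne: "norm (s (e k)) \<le> M * norm y * (1 / 2) ^ k" for k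
      using s(2)[of "e k"] mult_left_mono[OF e \<open>M \<ge> 0\<close>, of k] by (simp add: mult.assoc)
    have geo: "(\<lambda>k. M * norm y * (1 / 2) ^ k) sums (M * norm y * 2)"
      using geometric_sums[of "1 / 2 :: real"] by (intro sums_mult) simp
    have summable: "summable (\<lambda>k. s (e k))"
      by (rule summable_comparison_test'[OF sums_summable[OF geo] ne])
    define x where "x = (\<Sum>k. s (e k))"
    have sums: "(\<lambda>k. s (e k)) sums x"
      using summable by (simp add: x_def summable_sums)
    have "x \<in> V"
    proof (rule closed_sequentially[OF V(1)])
      show "(\<lambda>n. \<Sum>k<n. s (e k)) \<longlonglongrightarrow> x"
        using sums by (simp add: sums_def)
      show "(\<Sum>k<n. s (e k)) \<in> V" for n
        using s(1) V(2) by (simp add: subspace_sum)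
    qed
    moreover have "f x = y"
    proof -
      have "e \<longlonglongrightarrow> 0"
      proof (rule Lim_null_comparison)
        show "eventually (\<lambda>k. norm (e k) \<le> norm y * (1 / 2) ^ k) sequentially"
          using e by simp
        show "(\<lambda>k. norm y * (1 / 2) ^ k) \<longlonglongrightarrow> 0"
          by (intro tendsto_mult_right_zero LIMSEQ_power_zero) simp
      qed
      then have "(\<lambda>k. e k - e (Suc k)) sums (e 0 - 0)"
        by (rule telescope_sums')
      then have "(\<lambda>k. f (s (e k))) sums y"
        by (simp add: e_Suc) (simp add: e_def)
      with f.sums[OF sums] show ?thesis
        by (rule sums_unique2)
    qed
    moreover have "norm x \<le> 2 * M * norm y"
      using norm_suminf_le[of "\<lambda>k. s (e k)", OF ne sums_summable[OF geo]] sums_unique[OF geo]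
      by (simp add: x_def)
    ultimately show ?thesis
      by blast
  qed
  then show thesis
    by (rule that)
qed

section \<open>Generalized inverses and equivalent operators\<close>

definition generalized_inverse ::
  "('a::real_normed_vector \<Rightarrow>\<^sub>L 'b::real_normed_vector) \<Rightarrow> ('b \<Rightarrow>\<^sub>L 'a) \<Rightarrow> bool" where
  "generalized_inverse X A \<longleftrightarrow> (\<forall>x. X (A (X x)) = X x) \<and> (\<forall>y. A (X (A y)) = A y)"

text \<open>Passing to \<open>A X A\<close> supplies the second identity, so constructions need to
  secure only the first.\<close>

lemma generalized_inverse_exists:
  fixes X :: "'a::real_normed_vector \<Rightarrow>\<^sub>L 'b::real_normed_vector" and A :: "'b \<Rightarrow>\<^sub>L 'a"
  assumes "\<And>x. X (A (X x)) = X x"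
  shows "\<exists>A. generalized_inverse X A"
  using assms by (intro exI[of _ "A o\<^sub>L X o\<^sub>L A"]) (simp add: generalized_inverse_def)

lemma subspace_kernel: "subspace (kernel X)"
  by (simp add: subspace_def kernel_def blinfun.bilinear_simps)

lemma closed_kernel: "closed (kernel X)"
  unfolding kernel_def by (intro closed_Collect_eq continuous_intros)

lemma subspace_op_range: "subspace (op_range X)"
  by (intro linear_subspace_image bounded_linear.linear[OF blinfun.bounded_linear_right] subspace_UNIV)

text \<open>The map \<open>(r, n) \<mapsto> X r + n\<close> from \<open>R' \<times> N'\<close> to
  the target is a continuous linear bijection. Its inverse \<open>G\<close> is bounded by the open
  mapping theorem, and \<open>A\<close> is its first component.\<close>

lemma double_splitting_generalized_inverse:
  assumes "double_splitting X"
  shows "\<exists>A. generalized_inverse X A"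
proof -
  obtain R' N' where R': "closed R'" "complementary (kernel X) R'"
    and N': "closed N'" "complementary (op_range X) N'"
    using assms unfolding double_splitting_def by blast
  have sub: "subspace R'" "subspace N'"
    using R' N' by (auto simp: complementary_def)
  define f where "f = (\<lambda>p. X (fst p) + snd p)"
  have bl: "bounded_linear f"
    unfolding f_def by (intro bounded_linear_intros)
  have V: "closed (R' \<times> N')" "subspace (R' \<times> N')"
    using R' N' sub by (auto simp: closed_Times subspace_Times)
  have "f ` (R' \<times> N') = UNIV"
  proof (intro set_eqI iffI UNIV_I)
    fix y
    obtain x n where "n \<in> N'" "y = X x + n"
      using N'(2) unfolding complementary_def by blast
    moreover obtain k r where "k \<in> kernel X" "r \<in> R'" "x = k + r"
      using R'(2) unfolding complementary_def by blast
    ultimately have "y = f (r, n)" "(r, n) \<in> R' \<times> N'"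
      by (auto simp: f_def kernel_def blinfun.add_right)
    then show "y \<in> f ` (R' \<times> N')"
      by blast
  qed
  from open_mapping_bound[OF bl V this] obtain C
    where C: "\<And>y. \<exists>p\<in>R' \<times> N'. f p = y \<and> norm p \<le> C * norm y"
    by blast
  then obtain G where G: "\<And>y. G y \<in> R' \<times> N'" "\<And>y. f (G y) = y" "\<And>y. norm (G y) \<le> C * norm y"
    by metis
  have inj: "p = q" if "p \<in> R' \<times> N'" "q \<in> R' \<times> N'" "f p = f q" for p q
  proof -
    have "p - q \<in> R' \<times> N'"
      using that V(2) by (simp add: subspace_diff)
    moreover obtain r n where rn: "p - q = (r, n)"
      by (cases "p - q")
    ultimately have "r \<in> R'" "n \<in> N'"
      by auto
    have "f (p - q) = 0"
      using that(3) bl by (simp add: linear_diff bounded_linear.linear)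
    then have "X r + n = 0"
      by (simp add: rn f_def)
    then have "n = X (- r)"
      by (simp add: blinfun.minus_right eq_neg_iff_add_eq_0 add.commute)
    then have "n = 0"
      using N'(2) \<open>n \<in> N'\<close> unfolding complementary_def by blast
    then have "r \<in> kernel X"
      using \<open>X r + n = 0\<close> by (simp add: kernel_def)
    then have "r = 0"
      using R'(2) \<open>r \<in> R'\<close> unfolding complementary_def by blast
    with rn \<open>n = 0\<close> show ?thesis
      by (metis right_minus_eq zero_prod_def)
  qed
  have "bounded_linear G"
  proof (rule bounded_linear_intro)
    show "G (x + y) = G x + G y" for x y
      using bl V(2) G by (intro inj) (auto simp: linear_add bounded_linear.linear intro!: subspace_add)
    show "G (r *\<^sub>R x) = r *\<^sub>R G x" for r x
      using bl V(2) G by (intro inj) (auto simp: linear_scale bounded_linear.linear intro!: subspace_scale)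
    show "norm (G x) \<le> norm x * C" for x
      using G(3) by (simp add: mult.commute)
  qed
  then have "bounded_linear (\<lambda>y. fst (G y))"
    by (rule bounded_linear_fst_comp)
  then have A: "blinfun_apply (Blinfun (\<lambda>y. fst (G y))) = (\<lambda>y. fst (G y))"
    by (rule bounded_linear_Blinfun_apply)
  have "X (fst (G (X x))) = X x" for x
  proof -
    obtain k r where "k \<in> kernel X" "r \<in> R'" "x = k + r"
      using R'(2) unfolding complementary_def by blast
    then have "X x = X r" "(r, 0) \<in> R' \<times> N'"
      using sub by (auto simp: kernel_def blinfun.add_right subspace_0)
    moreover have "G (X x) = (r, 0)"
      using G calculation by (intro inj) (auto simp: f_def)
    ultimately show ?thesis
      by simp
  qed
  then show ?thesis
    by (intro generalized_inverse_exists[of X "Blinfun (\<lambda>y. fst (G y))"]) (simp add: A)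
qed

text \<open>\<open>A X\<close> and \<open>X A\<close> are projections, so the ranges of
  \<open>A\<close> and \<open>X\<close> are fixed-point sets and hence closed. Through this
  converse, double splitting passes to equivalent operators by transporting \<open>A\<close>
  alone.\<close>

lemma generalized_inverse_double_splitting:
  assumes "generalized_inverse X A"
  shows "double_splitting X"
proof -
  have A: "X (A (X x)) = X x" "A (X (A y)) = A y" for x y
    using assms by (auto simp: generalized_inverse_def)
  have range_eq: "op_range X = {y. X (A y) = y}"
    using A by (auto intro: rangeI simp: image_iff) metis
  show ?thesis
    unfolding double_splitting_def
  proof (intro conjI exI)
    show "closed (op_range X)"
      unfolding range_eq by (intro closed_Collect_eq continuous_intros)
    have *: "op_range A = {x. A (X x) = x}"
      using A by (auto intro: rangeI simp: image_iff) metis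
    show "closed (op_range A)"
      unfolding * by (intro closed_Collect_eq continuous_intros)
    show "complementary (kernel X) (op_range A)"
      unfolding complementary_def
    proof (intro conjI allI subspace_kernel subspace_op_range)
      show "kernel X \<inter> op_range A = {0}"
        unfolding * by (auto simp: kernel_def)
      fix x
      have "x - A (X x) \<in> kernel X" "x = (x - A (X x)) + A (X x)"
        by (auto simp: kernel_def blinfun.diff_right A)
      then show "\<exists>v\<in>kernel X. \<exists>w\<in>op_range A. x = v + w"
        by blast
    qed
    show "closed (kernel A)"
      by (rule closed_kernel)
    show "complementary (op_range X) (kernel A)"
      unfolding complementary_def
    proof (intro conjI allI subspace_kernel subspace_op_range)
      show "op_range X \<inter> kernel A = {0}"
        unfolding range_eq by (auto simp: kernel_def)
      fix y
      have "y - X (A y) \<in> kernel A" "y = X (A y) + (y - X (A y))"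
        by (auto simp: kernel_def blinfun.diff_right A)
      then show "\<exists>v\<in>op_range X. \<exists>w\<in>kernel A. y = v + w"
        by blast
    qed
  qed
qed

lemma finite_rank_generalized_inverse:
  fixes X :: "'a::real_normed_vector \<Rightarrow>\<^sub>L 'b::real_normed_vector"
  assumes "edim (op_range X) = enat k"
  shows "\<exists>A. generalized_inverse X A"
proof -
  obtain B where B: "finite B" "span B = op_range X"
    using assms unfolding edim_def by (auto split: if_splits)
  then have "B \<subseteq> op_range X"
    using span_superset[of B] by simp
  with B(1) obtain A :: "'b \<Rightarrow>\<^sub>L 'a" where A: "\<And>b. b \<in> B \<Longrightarrow> X (A b) = b"
    using finite_rank_right_inverse[of B X] by metis
  have "X (A y) = y" if "y \<in> span B" for y
    using that
  proof (induction rule: span_induct)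
    case base
    show ?case
      by (simp add: subspace_def blinfun.bilinear_simps)
  next
    case (step x)
    then show ?case
      by (rule A)
  qed
  then show ?thesis
    using B(2) by (intro generalized_inverse_exists) auto
qed

section \<open>Invariance under invertible factors on both sides\<close>

definition invertible_pair :: "('a::real_normed_vector \<Rightarrow>\<^sub>L 'a) \<Rightarrow> ('a \<Rightarrow>\<^sub>L 'a) \<Rightarrow> bool" where
  "invertible_pair C C' \<longleftrightarrow> C o\<^sub>L C' = id_blinfun \<and> C' o\<^sub>L C = id_blinfun"

lemma invertible_pairD:
  assumes "invertible_pair C C'"
  shows "C (C' x) = x" "C' (C x) = x"
  using assms unfolding invertible_pair_def
  by (metis blinfun_apply_blinfun_compose blinfun_apply_id_blinfun id_apply)+

lemma invertible_pair_sym: "invertible_pair C C' \<Longrightarrow> invertible_pair C' C"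
  by (auto simp: invertible_pair_def)

lemma dim_inj_on_image:
  fixes f :: "'a::real_vector \<Rightarrow> 'b::real_vector"
  assumes "linear f" "inj_on f (span V)"
  shows "dim (f ` V) = dim V"
proof -
  obtain B where B: "B \<subseteq> V" "independent B" "V \<subseteq> span B" "card B = dim V"
    using basis_exists .
  have inj: "inj_on f (span B)"
    using assms(2) span_mono[OF B(1)] by (rule inj_on_subset)
  have "span B = span V"
    using B by (simp add: span_eq span_superset subset_trans[OF B(1) span_superset])
  then have "span (f ` B) = span (f ` V)"
    by (simp add: linear_span_image[OF assms(1)])
  moreover have "independent (f ` B)"
    using assms(1) B(2) inj by (rule linear_independent_injective_image)
  ultimately have "dim (f ` V) = card (f ` B)"
    by (rule dim_eq_card)
  also have "\<dots> = card B"
    using inj span_superset by (intro card_image) (rule inj_on_subset)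
  finally show ?thesis
    using B(4) by simp
qed

lemma edim_inj_image:
  assumes "linear f" "inj f"
  shows "edim (f ` V) = edim V"
proof -
  have "(\<exists>B. finite B \<and> span B = f ` V) \<longleftrightarrow> (\<exists>B. finite B \<and> span B = V)"
  proof
    assume "\<exists>B. finite B \<and> span B = f ` V"
    then obtain B where B: "finite B" "span B = f ` V"
      by blast
    then have "B \<subseteq> f ` V"
      using span_superset[of B] by simp
    then obtain B' where "finite B'" "B = f ` B'"
      using finite_subset_image[OF B(1)] by metis
    moreover have "f ` span B' = f ` V"
      using B calculation by (simp add: linear_span_image[OF assms(1)])
    then have "span B' = V"
      using assms(2) by (simp add: inj_image_eq_iff)
    ultimately show "\<exists>B. finite B \<and> span B = V"
      by blast
  next
    assume "\<exists>B. finite B \<and> span B = V"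
    then show "\<exists>B. finite B \<and> span B = f ` V"
      using linear_span_image[OF assms(1)] by (metis finite_imageI)
  qed
  moreover have "dim (f ` V) = dim V"
    using assms by (intro dim_inj_on_image) (auto intro: inj_on_subset)
  ultimately show ?thesis
    by (simp add: edim_def)
qed

lemma has_codim_bij_image:
  assumes "linear f" "bij f" "has_codim V d"
  shows "has_codim (f ` V) d"
proof -
  have "inj f" "surj f"
    using assms(2) by (auto simp: bij_def)
  obtain W where W: "complementary V W" "edim W = d"
    using assms(3) unfolding has_codim_def by blast
  have "complementary (f ` V) (f ` W)"
    unfolding complementary_def
  proof (intro conjI allI)
    show "subspace (f ` V)" "subspace (f ` W)"
      using W(1) assms(1) by (auto simp: complementary_def linear_subspace_image)
    have "f ` V \<inter> f ` W = f ` {0}"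
      using W(1) \<open>inj f\<close> by (simp add: complementary_def flip: image_Int)
    then show "f ` V \<inter> f ` W = {0}"
      by (simp add: linear_0[OF assms(1)])
    fix y
    obtain x where "y = f x"
      using \<open>surj f\<close> by blast
    moreover obtain v w where "v \<in> V" "w \<in> W" "x = v + w"
      using W(1) unfolding complementary_def by blast
    ultimately show "\<exists>v\<in>f ` V. \<exists>w\<in>f ` W. y = v + w"
      by (auto simp: linear_add[OF assms(1)])
  qed
  moreover have "edim (f ` W) = d"
    using W(2) edim_inj_image[OF assms(1) \<open>inj f\<close>] by simp
  ultimately show ?thesis
    unfolding has_codim_def by blast
qed

lemma invertible_pair_bij:
  assumes "invertible_pair C C'"
  shows "bij C" "linear C"
  using invertible_pairD[OF assms]
  by (auto intro!: o_bij[of C'] bounded_linear.linear[OF blinfun.bounded_linear_right])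

lemma op_range_compose:
  assumes "invertible_pair D D'"
  shows "op_range (C o\<^sub>L T o\<^sub>L D) = C ` op_range T"
proof -
  have "C (T x) \<in> op_range (C o\<^sub>L T o\<^sub>L D)" for x
    by (rule range_eqI[of _ _ "D' x"]) (simp add: invertible_pairD(1)[OF assms])
  then show ?thesis
    by auto
qed

lemma kernel_compose:
  assumes C: "invertible_pair C C'" and D: "invertible_pair D D'"
  shows "kernel (C o\<^sub>L T o\<^sub>L D) = D' ` kernel T"
proof (intro set_eqI iffI)
  fix x assume "x \<in> kernel (C o\<^sub>L T o\<^sub>L D)"
  then have "C (T (D x)) = C 0"
    by (simp add: kernel_def)
  then have "D x \<in> kernel T"
    using invertible_pairD(2)[OF C, of "T (D x)"] by (simp add: kernel_def)
  then show "x \<in> D' ` kernel T"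
    using invertible_pairD(2)[OF D, of x] by (metis imageI)
next
  fix x assume "x \<in> D' ` kernel T"
  then obtain y where "x = D' y" "T y = 0"
    by (auto simp: kernel_def)
  then show "x \<in> kernel (C o\<^sub>L T o\<^sub>L D)"
    by (simp add: kernel_def invertible_pairD(1)[OF D])
qed

lemma rank_class_compose:
  assumes "invertible_pair C C'" "invertible_pair D D'" "T \<in> rank_class k"
  shows "C o\<^sub>L T o\<^sub>L D \<in> rank_class k"
  using assms invertible_pair_bij[OF assms(1)]
  unfolding rank_class_def mem_Collect_eq op_range_compose[OF assms(2)]
  by (simp add: edim_inj_image bij_def)

lemma Phi_compose:
  assumes C: "invertible_pair C C'" and D: "invertible_pair D D'" and T: "T \<in> Phi m n"
  shows "C o\<^sub>L T o\<^sub>L D \<in> Phi m n"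
proof -
  obtain A where A: "generalized_inverse T A"
    using T double_splitting_generalized_inverse by (auto simp: Phi_def)
  have "generalized_inverse (C o\<^sub>L T o\<^sub>L D) (D' o\<^sub>L A o\<^sub>L C')"
    using A by (simp add: generalized_inverse_def invertible_pairD[OF C] invertible_pairD[OF D])
  then have "double_splitting (C o\<^sub>L T o\<^sub>L D)"
    by (rule generalized_inverse_double_splitting)
  moreover have "edim (kernel (C o\<^sub>L T o\<^sub>L D)) = m"
    using T invertible_pair_bij[OF invertible_pair_sym[OF D]]
    by (simp add: kernel_compose[OF C D] Phi_def edim_inj_image bij_def)
  moreover have "has_codim (op_range (C o\<^sub>L T o\<^sub>L D)) n"
    using T invertible_pair_bij[OF C]
    unfolding op_range_compose[OF D] by (simp add: Phi_def has_codim_bij_image)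
  ultimately show ?thesis
    by (simp add: Phi_def)
qed

section \<open>Nested subspaces of equal finite dimension or codimension\<close>

text \<open>A vector of \<open>W\<close> outside \<open>V\<close> would enlarge a basis of
  \<open>V\<close> to \<open>k + 1\<close> independent vectors in \<open>W\<close>.\<close>

lemma subspace_eq_of_edim_eq:
  assumes "subspace V" "V \<subseteq> W" "edim V = enat k" "edim W = enat k"
  shows "V = W"
proof -
  obtain B where B: "finite B" "span B = W"
    using assms(4) unfolding edim_def by (auto split: if_splits)
  have dims: "dim V = k" "dim W = k"
    using assms(3,4) unfolding edim_def by (auto split: if_splits)
  obtain C where C: "C \<subseteq> V" "independent C" "V \<subseteq> span C" "card C = dim V"
    using basis_exists .
  have "finite C"
    using independent_span_bound[OF B(1) C(2)] C(1) assms(2) B(2) by blast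
  have "W \<subseteq> span C"
  proof
    fix w assume "w \<in> W"
    show "w \<in> span C"
    proof (rule ccontr)
      assume "w \<notin> span C"
      then have "independent (insert w C)" "w \<notin> C"
        using C(2) by (auto simp: independent_insertI span_base)
      moreover have "insert w C \<subseteq> W"
        using \<open>w \<in> W\<close> C(1) assms(2) by blast
      ultimately obtain E where E: "insert w C \<subseteq> E" "E \<subseteq> W" "independent E" "W \<subseteq> span E"
        using maximal_independent_subset_extend by metis
      have "finite E"
        using independent_span_bound[OF B(1) E(3)] E(2) B(2) by blast
      then have "card (insert w C) \<le> dim W"
        using E basis_card_eq_dim[OF E(2,4,3)] by (metis card_mono)
      then show False
        using \<open>w \<notin> C\<close> \<open>finite C\<close> C(4) dims by simp
    qed
  qed
  moreover have "span C \<subseteq> V"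
    using C(1) assms(1) by (rule span_minimal)
  ultimately show ?thesis
    using assms(2) by blast
qed

text \<open>The projection \<open>\<pi>\<close> onto \<open>W\<close> along \<open>V\<close> plays
  the role of the quotient map. It is injective on \<open>W'\<close>, so by dimension it maps
  \<open>W'\<close> onto \<open>W\<close>; then \<open>x\<close> in \<open>V'\<close> differs from
  some \<open>w\<close> in \<open>W'\<close> by an element of \<open>V\<close>, and \<open>w\<close>
  lies in \<open>V' \<inter> W'\<close>.\<close>

lemma subspace_eq_of_codim_eq:
  assumes VV': "V \<subseteq> V'" and "has_codim V (enat n)" "has_codim V' (enat n)"
  shows "V = V'"
proof -
  obtain W W' where W: "complementary V W" "edim W = enat n"
    and W': "complementary V' W'" "edim W' = enat n"
    using assms unfolding has_codim_def by blast
  have sub: "subspace V" "subspace W" "subspace V'" "subspace W'"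
    using W W' by (auto simp: complementary_def)
  have "\<exists>w. w \<in> W \<and> x - w \<in> V" for x
    using W(1) unfolding complementary_def by (metis add_diff_cancel_right')
  then obtain \<pi> where \<pi>: "\<And>x. \<pi> x \<in> W" "\<And>x. x - \<pi> x \<in> V"
    by metis
  have \<pi>_unique: "\<pi> x = w" if "w \<in> W" "x - w \<in> V" for x w
  proof -
    have "\<pi> x - w \<in> W"
      using that \<pi> sub by (simp add: subspace_diff)
    moreover have "\<pi> x - w \<in> V"
      using subspace_diff[OF sub(1) that(2) \<pi>(2)[of x]] by simp
    moreover have "V \<inter> W \<subseteq> {0}"
      using W(1) by (simp add: complementary_def)
    ultimately have "\<pi> x - w = 0"
      by blast
    then show ?thesis
      by simp
  qed
  have lin: "linear \<pi>"
  proof (intro linearI \<pi>_unique)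
    show "\<pi> x + \<pi> y \<in> W" for x y
      using \<pi> sub by (simp add: subspace_add)
    show "r *\<^sub>R \<pi> x \<in> W" for r x
      using \<pi> sub by (simp add: subspace_scale)
    show "x + y - (\<pi> x + \<pi> y) \<in> V" for x y
      using subspace_add[OF sub(1) \<pi>(2)[of x] \<pi>(2)[of y]] by (simp add: algebra_simps)
    show "r *\<^sub>R x - r *\<^sub>R \<pi> x \<in> V" for r x
      using subspace_scale[OF sub(1) \<pi>(2)[of x], of r] by (simp add: algebra_simps)
  qed
  have inj: "inj_on \<pi> W'"
  proof (subst linear_inj_on_iff_eq_0[OF lin sub(4)], intro ballI impI)
    fix w assume "w \<in> W'" "\<pi> w = 0"
    then have "w \<in> V' \<inter> W'"
      using \<pi>(2)[of w] VV' by auto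
    then show "w = 0"
      using W'(1) by (auto simp: complementary_def)
  qed
  have "edim (\<pi> ` W') = enat n"
  proof -
    obtain B where "finite B" "span B = W'"
      using W'(2) unfolding edim_def by (auto split: if_splits)
    then have "\<exists>B. finite B \<and> span B = \<pi> ` W'"
      by (intro exI[of _ "\<pi> ` B"]) (simp add: linear_span_image[OF lin])
    moreover have "dim (\<pi> ` W') = dim W'"
      using inj sub(4) by (intro dim_inj_on_image lin) (metis span_eq_iff)
    ultimately show ?thesis
      using W'(2) unfolding edim_def by (auto split: if_splits)
  qed
  then have "\<pi> ` W' = W"
    using W(2) \<pi> sub lin by (intro subspace_eq_of_edim_eq[of _ _ n]) (auto simp: linear_subspace_image)
  have "V' \<subseteq> V"
  proof
    fix x assume "x \<in> V'"
    obtain w where w: "w \<in> W'" "\<pi> x = \<pi> w"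
      using \<open>\<pi> ` W' = W\<close> \<pi>(1)[of x] by blast
    have "(x - \<pi> x) - (w - \<pi> w) \<in> V"
      using sub(1) \<pi>(2) \<pi>(2) by (rule subspace_diff)
    then have "x - w \<in> V"
      using w by simp
    with VV' have "x - w \<in> V'"
      by blast
    from subspace_diff[OF sub(3) \<open>x \<in> V'\<close> this] have "w \<in> V'"
      by simp
    then have "w = 0"
      using w W'(1) by (auto simp: complementary_def)
    with \<open>x - w \<in> V\<close> show "x \<in> V"
      by simp
  qed
  with VV' show ?thesis
    by blast
qed

section \<open>Charts and tangent vectors\<close>

text \<open>\<open>1 - A X\<close> projects onto the kernel of \<open>X\<close> and
  \<open>1 - X A\<close> onto the kernel of \<open>A\<close>, so this is the block of
  \<open>Z\<close> from the kernel of \<open>X\<close> to the complement of its range.\<close>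

definition defect ::
  "('a::real_normed_vector \<Rightarrow>\<^sub>L 'b::real_normed_vector) \<Rightarrow> ('b \<Rightarrow>\<^sub>L 'a) \<Rightarrow> ('a \<Rightarrow>\<^sub>L 'b) \<Rightarrow> ('a \<Rightarrow>\<^sub>L 'b)" where
  "defect X A Z = (id_blinfun - (X o\<^sub>L A)) o\<^sub>L Z o\<^sub>L (id_blinfun - (A o\<^sub>L X))"

lemma defect_apply:
  "defect X A Z x = (Z x - Z (A (X x))) - X (A (Z x - Z (A (X x))))"
  by (simp add: defect_def blinfun.bilinear_simps)

lemma bounded_linear_defect: "bounded_linear (defect X A)"
  unfolding defect_def by (intro bounded_linear_intros)

lemma M_space_eq:
  assumes "generalized_inverse X A"
  shows "M_space X = {Z. defect X A Z = 0}"
proof (intro set_eqI iffI)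
  have XAX: "X (A (X x)) = X x" for x
    using assms by (simp add: generalized_inverse_def)
  fix Z
  {
    assume Z: "Z \<in> M_space X"
    have "defect X A Z x = 0" for x
    proof -
      have "x - A (X x) \<in> kernel X"
        by (simp add: kernel_def blinfun.diff_right XAX)
      then have "Z (x - A (X x)) \<in> op_range X"
        using Z unfolding M_space_def by blast
      then obtain w where "Z (x - A (X x)) = X w"
        by blast
      then show ?thesis
        by (simp add: defect_apply blinfun.diff_right[symmetric] XAX)
    qed
    then show "Z \<in> {Z. defect X A Z = 0}"
      by (auto intro: blinfun_eqI)
  next
    assume "Z \<in> {Z. defect X A Z = 0}"
    then have Z: "defect X A Z x = 0" for x
      by simp
    have "Z x \<in> op_range X" if "x \<in> kernel X" for x
      using Z[of x] that by (simp add: kernel_def defect_apply)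
    then show "Z \<in> M_space X"
      by (auto simp: M_space_def)
  }
qed

lemma defect_idem:
  assumes "generalized_inverse X A"
  shows "defect X A (defect X A Z) = defect X A Z"
  using assms by (intro blinfun_eqI)
    (simp add: defect_apply generalized_inverse_def blinfun.bilinear_simps)

lemma closed_complemented_M_space:
  assumes X: "generalized_inverse X A"
  shows "closed_complemented (M_space X)"
proof -
  have lin: "linear (defect X A)"
    by (rule bounded_linear.linear[OF bounded_linear_defect])
  have cont: "continuous_on UNIV (defect X A)"
    by (rule linear_continuous_on[OF bounded_linear_defect])
  have "complementary (M_space X) {Z. defect X A Z = Z}"
    unfolding complementary_def M_space_eq[OF X]
  proof (intro conjI allI)
    show "subspace {Z. defect X A Z = 0}" "subspace {Z. defect X A Z = Z}"
      by (auto simp: subspace_def linear_0[OF lin] linear_add[OF lin] linear_scale[OF lin])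
    show "{Z. defect X A Z = 0} \<inter> {Z. defect X A Z = Z} = {0}"
      by (auto simp: linear_0[OF lin])
    fix Z
    have "defect X A (Z - defect X A Z) = 0"
      by (simp add: linear_diff[OF lin] defect_idem[OF X])
    then show "\<exists>v\<in>{Z. defect X A Z = 0}. \<exists>w\<in>{Z. defect X A Z = Z}. Z = v + w"
      by (intro bexI[of _ "Z - defect X A Z"] bexI[of _ "defect X A Z"]) (auto simp: defect_idem[OF X])
  qed
  moreover have "closed (M_space X)" "closed {Z. defect X A Z = Z}"
    unfolding M_space_eq[OF X] by (intro closed_Collect_eq cont continuous_on_const continuous_on_id)+
  ultimately show ?thesis
    unfolding closed_complemented_def by blast
qed

lemma quasi_inverse_invertible_pair:
  assumes "quasi_inverse (sandwich A) H g"
  shows "invertible_pair (id_blinfun + (H o\<^sub>L A)) (id_blinfun - (g o\<^sub>L A))"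
proof -
  have "H (A (g y)) = H y - g y" "g (A (H y)) = H y - g y" for y
    using assms by (auto simp: quasi_inverse_def simp flip: sandwich_apply blinfun.diff_left)
  then show ?thesis
    unfolding invertible_pair_def by (intro conjI blinfun_eqI) (simp_all add: blinfun.bilinear_simps)
qed

lemma square_zero_invertible_pair:
  fixes V :: "'a::real_normed_vector \<Rightarrow>\<^sub>L 'a"
  assumes "\<And>x. V (V x) = 0"
  shows "invertible_pair (id_blinfun + V) (id_blinfun - V)"
  unfolding invertible_pair_def
  by (intro conjI blinfun_eqI) (simp_all add: blinfun.bilinear_simps assms)

text \<open>
  \<open>(1 + H A) (X + defect g) (1 + A g (1 - A X)) = X + H\<close> for the quasi-inverse \<open>g = (1 + H A)\<^sup>-\<^sup>1 H\<close>.
\<close>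

lemma perturbation_equivalent:
  assumes X: "generalized_inverse X A" and g: "quasi_inverse (sandwich A) H g"
  obtains C C' D D' where "invertible_pair C C'" "invertible_pair D D'"
    "X + H = C o\<^sub>L (X + defect X A g) o\<^sub>L D" "X + defect X A g = C' o\<^sub>L (X + H) o\<^sub>L D'"
proof -
  have A: "X (A (X x)) = X x" "A (X (A y)) = A y" for x y
    using X by (auto simp: generalized_inverse_def)
  have gH: "g (A (H x)) = H x - g x" for x
    using g by (auto simp: quasi_inverse_def simp flip: sandwich_apply blinfun.diff_left)
  define C where "C = id_blinfun + (H o\<^sub>L A)"
  define C' where "C' = id_blinfun - (g o\<^sub>L A)"
  \<comment> \<open>\<open>X V\<close> is the part of \<open>g (1 - A X)\<close> inside the range of
    \<open>X\<close>. Since \<open>(1 - A X) A = 0\<close>, both \<open>V V\<close> and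
    \<open>defect X A g\<close> composed with \<open>V\<close> vanish, so
    \<open>(X + defect X A g) (1 + V)\<close> is just \<open>X + g (1 - A X)\<close>.\<close>
  define V where "V = A o\<^sub>L g o\<^sub>L (id_blinfun - (A o\<^sub>L X))"
  define D where "D = id_blinfun + V"
  define D' where "D' = id_blinfun - V"
  have C: "invertible_pair C C'"
    unfolding C_def C'_def by (rule quasi_inverse_invertible_pair[OF g])
  have D: "invertible_pair D D'"
    unfolding D_def D'_def
    by (rule square_zero_invertible_pair) (simp add: V_def A blinfun.bilinear_simps)
  have eq: "X + defect X A g = C' o\<^sub>L (X + H) o\<^sub>L D'"
    by (intro blinfun_eqI)
      (simp add: C'_def D'_def V_def defect_apply A gH blinfun.bilinear_simps)
  have "X + H = C o\<^sub>L (X + defect X A g) o\<^sub>L D"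
    by (intro blinfun_eqI) (simp add: eq invertible_pairD[OF C] invertible_pairD[OF D])
  with C D eq show thesis
    by (intro that)
qed

section \<open>Geometry of classes invariant under equivalence\<close>

text \<open>The conditions on \<open>U\<close> make \<open>X + U\<close> block diagonal:
  \<open>X\<close> acts on the range of \<open>A\<close>, and \<open>U\<close> maps the kernel of
  \<open>X\<close> into the kernel of \<open>A\<close>. \<open>rigid\<close> says that the class
  leaves no room for this second block.\<close>

locale rigid_orbits =
  fixes S :: "('a::banach \<Rightarrow>\<^sub>L 'b::banach) set"
  assumes generalized_inverse_ex: "X \<in> S \<Longrightarrow> \<exists>A. generalized_inverse X A"
    and orbit: "T \<in> S \<Longrightarrow> invertible_pair C C' \<Longrightarrow> invertible_pair D D' \<Longrightarrow> C o\<^sub>L T o\<^sub>L D \<in> S"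
    and rigid: "X \<in> S \<Longrightarrow> generalized_inverse X A \<Longrightarrow> X + U \<in> S \<Longrightarrow>
      (\<And>x. A (U x) = 0) \<Longrightarrow> (\<And>y. U (A y) = 0) \<Longrightarrow> U = 0"
begin

lemma perturbation_in_iff:
  assumes "X \<in> S" and X: "generalized_inverse X A" and g: "quasi_inverse (sandwich A) H g"
  shows "X + H \<in> S \<longleftrightarrow> g \<in> M_space X"
proof -
  obtain C C' D D' where CD: "invertible_pair C C'" "invertible_pair D D'"
    "X + H = C o\<^sub>L (X + defect X A g) o\<^sub>L D" "X + defect X A g = C' o\<^sub>L (X + H) o\<^sub>L D'"
    using perturbation_equivalent[OF X g] .
  have "X + H \<in> S \<longleftrightarrow> X + defect X A g \<in> S"
    using CD orbit invertible_pair_sym by metis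
  also have "\<dots> \<longleftrightarrow> defect X A g = 0"
  proof
    assume "X + defect X A g \<in> S"
    then show "defect X A g = 0"
      using X by (intro rigid[OF \<open>X \<in> S\<close> X])
        (simp_all add: generalized_inverse_def defect_apply blinfun.bilinear_simps)
  qed (simp add: \<open>X \<in> S\<close>)
  finally show ?thesis
    by (simp add: M_space_eq[OF X])
qed

lemma smooth_submanifold: "smooth_submanifold S"
  unfolding smooth_submanifold_def
proof (rule ballI)
  fix X assume "X \<in> S"
  then obtain A where X: "generalized_inverse X A"
    using generalized_inverse_ex by blast
  interpret pos: banach_multiplication "sandwich A"
    by (rule banach_multiplication_sandwich)
  interpret neg: banach_multiplication "sandwich (- A)"
    by (rule banach_multiplication_sandwich)
  define W where "W = {T. T - X \<in> quasi_regular (sandwich A)}"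
  define \<phi> where "\<phi> T = quasi (sandwich A) (T - X)" for T
  define \<psi> where "\<psi> Z = quasi (sandwich (- A)) Z + X" for Z
  have \<phi>: "\<phi> T \<in> quasi_regular (sandwich (- A)) \<and> \<psi> (\<phi> T) = T" if "T \<in> W" for T
  proof -
    have "quasi_inverse (sandwich A) (T - X) (\<phi> T)"
      using that unfolding W_def \<phi>_def by (intro pos.quasi_inverse_quasi) simp
    then have "quasi_inverse (sandwich (- A)) (\<phi> T) (T - X)"
      by (simp add: quasi_inverse_sandwich_uminus)
    then show ?thesis
      using neg.quasi_eq by (auto simp: quasi_regular_def \<psi>_def)
  qed
  have \<psi>: "\<psi> Z \<in> W \<and> \<phi> (\<psi> Z) = Z" if "Z \<in> quasi_regular (sandwich (- A))" for Z
  proof -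
    have "quasi_inverse (sandwich (- A)) Z (\<psi> Z - X)"
      using neg.quasi_inverse_quasi[OF that] by (simp add: \<psi>_def)
    then have "quasi_inverse (sandwich A) (\<psi> Z - X) Z"
      by (simp add: quasi_inverse_sandwich_uminus)
    then show ?thesis
      using pos.quasi_eq by (auto simp: quasi_regular_def \<phi>_def W_def)
  qed
  have img: "\<phi> ` W = quasi_regular (sandwich (- A))"
    using \<phi> \<psi> by (auto intro!: image_eqI[of _ \<phi>])
  have inj: "inj_on \<phi> W"
    using \<phi> by (metis inj_onI)
  have "smooth_diffeo_on W \<phi>"
    unfolding smooth_diffeo_on_def
  proof (intro conjI inj)
    have "W = (\<lambda>T. T - X) -` quasi_regular (sandwich A)"
      by (auto simp: W_def)
    then show "open W"
      by (auto intro!: open_vimage pos.open_quasi_regular continuous_intros)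
    show "open (\<phi> ` W)"
      unfolding img by (rule neg.open_quasi_regular)
    show "smooth_on W \<phi>"
      unfolding W_def \<phi>_def by (rule smooth_on_translate[OF pos.smooth_on_quasi])
    have "smooth_on (\<phi> ` W) \<psi>"
      unfolding img \<psi>_def by (rule smooth_on_add_const[OF neg.smooth_on_quasi])
    then show "smooth_on (\<phi> ` W) (inv_into W \<phi>)"
    proof (rule smooth_on_cong)
      fix Z assume "Z \<in> \<phi> ` W"
      then obtain T where "T \<in> W" "Z = \<phi> T"
        by blast
      then show "\<psi> Z = inv_into W \<phi> Z"
        using \<phi> inj by simp
    qed
  qed
  moreover have "\<phi> ` (S \<inter> W) = M_space X \<inter> \<phi> ` W"
  proof -
    have "T \<in> S \<longleftrightarrow> \<phi> T \<in> M_space X" if "T \<in> W" for T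
    proof -
      have "quasi_inverse (sandwich A) (T - X) (\<phi> T)"
        using that unfolding W_def \<phi>_def by (intro pos.quasi_inverse_quasi) simp
      from perturbation_in_iff[OF \<open>X \<in> S\<close> X this] show ?thesis
        by simp
    qed
    then show ?thesis
      by auto
  qed
  moreover have "X \<in> W"
    using pos.quasi_inverse_0 by (auto simp: W_def quasi_regular_def)
  ultimately show "\<exists>G\<^sub>0 W. \<exists>\<phi> :: ('a \<Rightarrow>\<^sub>L 'b) \<Rightarrow> ('a \<Rightarrow>\<^sub>L 'b).
      closed_complemented G\<^sub>0 \<and> open W \<and> X \<in> W \<and> smooth_diffeo_on W \<phi> \<and>
      \<phi> ` (S \<inter> W) \<subseteq> G\<^sub>0 \<and> openin (top_of_set G\<^sub>0) (\<phi> ` (S \<inter> W))"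
    using closed_complemented_M_space[OF X] unfolding smooth_diffeo_on_def
    by (intro exI[of _ "M_space X"] exI[of _ W] exI[of _ \<phi>]) (auto simp: openin_open)
qed

text \<open>The chart has the identity as derivative at \<open>X\<close>, so the curve read in the
  chart still has velocity \<open>Z\<close>, while its defect vanishes near
  \<open>0\<close>.\<close>

lemma tangent_vector_in_M_space:
  assumes c: "(c has_vector_derivative Z) (at 0)" "\<epsilon> > 0" "\<And>t. t \<in> {-\<epsilon><..<\<epsilon>} \<Longrightarrow> c t \<in> S" "c 0 = X"
  shows "Z \<in> M_space X"
proof -
  have "X \<in> S"
    using c(2) c(3)[of 0] c(4) by simp
  then obtain A where X: "generalized_inverse X A"
    using generalized_inverse_ex by blast
  interpret banach_multiplication "sandwich A"
    by (rule banach_multiplication_sandwich)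
  let ?q = "quasi (sandwich A)"
  have q0: "?q 0 = 0"
    by (rule quasi_eq[OF quasi_inverse_0])
  have "0 \<in> quasi_regular (sandwich A)"
    using quasi_inverse_0 by (auto simp: quasi_regular_def)
  from has_derivative_quasi[OF this] have "(?q has_derivative (\<lambda>v. v)) (at 0)"
    by (simp add: q0 zero_left zero_right)
  then have "(?q has_derivative (\<lambda>v. v)) (at (c 0 - X))"
    by (simp add: c(4))
  moreover have "((\<lambda>t. c t - X) has_derivative (\<lambda>t. t *\<^sub>R Z)) (at 0)"
    using c(1) unfolding has_vector_derivative_def by (auto intro!: derivative_eq_intros)
  ultimately have "((\<lambda>t. ?q (c t - X)) has_derivative (\<lambda>t. t *\<^sub>R Z)) (at 0)"
    by (rule has_derivative_compose[rotated])
  then have "((\<lambda>t. defect X A (?q (c t - X))) has_derivative (\<lambda>t. defect X A (t *\<^sub>R Z))) (at 0)"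
    by (rule bounded_linear.has_derivative[OF bounded_linear_defect])
  then have deriv: "((\<lambda>t. defect X A (?q (c t - X))) has_vector_derivative defect X A Z) (at 0)"
    unfolding has_vector_derivative_def
    by (simp add: linear_scale[OF bounded_linear.linear[OF bounded_linear_defect]])
  have "isCont c 0"
    using c(1) has_vector_derivative_continuous by blast
  then have "((\<lambda>t. c t - X) \<longlongrightarrow> 0) (at 0)"
    using c(4) by (simp add: isCont_def LIM_zero)
  then have "eventually (\<lambda>t. c t - X \<in> quasi_regular (sandwich A)) (at 0)"
    using open_quasi_regular \<open>0 \<in> quasi_regular (sandwich A)\<close> by (rule topological_tendstoD)
  moreover have "eventually (\<lambda>t. t \<in> {-\<epsilon><..<\<epsilon>}) (at 0)"
    using c(2) by (intro eventually_at_in_open') auto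
  ultimately have "eventually (\<lambda>t. defect X A (?q (c t - X)) = 0) (at 0)"
  proof eventually_elim
    case (elim t)
    have "X + (c t - X) \<in> S"
      using c(3) elim by simp
    then have "?q (c t - X) \<in> M_space X"
      using perturbation_in_iff[OF \<open>X \<in> S\<close> X quasi_inverse_quasi[OF elim(1)]] by simp
    then show ?case
      by (simp add: M_space_eq[OF X])
  qed
  \<comment> \<open>The filter \<open>at 0\<close> omits the point itself, whose value the transfer
    of derivatives also requires.\<close>
  moreover have "defect X A (?q (c 0 - X)) = 0"
    by (simp add: c(4) q0 linear_0[OF bounded_linear.linear[OF bounded_linear_defect]])
  ultimately have "((\<lambda>t. 0) has_vector_derivative defect X A Z) (at 0)"
    using has_derivative_transform_eventually[OF deriv[unfolded has_vector_derivative_def],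
        of "\<lambda>t. 0"]
    unfolding has_vector_derivative_def by blast
  then have "defect X A Z = 0"
    using vector_derivative_unique_at has_vector_derivative_const by blast
  then show ?thesis
    by (simp add: M_space_eq[OF X])
qed

text \<open>For \<open>Z\<close> in \<open>M_space X\<close> one has \<open>X V = Z - Z A X\<close>,
  so the product of the two factors around \<open>X\<close> collapses to
  \<open>X + t Z + t^2 Z V\<close>. The left factor is invertible for small \<open>t\<close>, the
  right one always, because \<open>V V = 0\<close>.\<close>

lemma curve_with_tangent:
  assumes "X \<in> S" "Z \<in> M_space X"
  shows "\<exists>c \<epsilon>. \<epsilon> > (0::real) \<and> c C1_differentiable_on {-\<epsilon><..<\<epsilon>} \<and>
    (\<forall>t\<in>{-\<epsilon><..<\<epsilon>}. c t \<in> S) \<and> c 0 = X \<and> vector_derivative c (at 0) = Z"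
proof -
  obtain A where X: "generalized_inverse X A"
    using generalized_inverse_ex[OF \<open>X \<in> S\<close>] by blast
  have A: "X (A (X x)) = X x" "A (X (A y)) = A y" for x y
    using X by (auto simp: generalized_inverse_def)
  interpret banach_multiplication "sandwich A"
    by (rule banach_multiplication_sandwich)
  define V where "V = A o\<^sub>L Z o\<^sub>L (id_blinfun - (A o\<^sub>L X))"
  define c where "c t = X + t *\<^sub>R Z + t\<^sup>2 *\<^sub>R (Z o\<^sub>L V)" for t
  have "defect X A Z = 0"
    using assms(2) by (simp add: M_space_eq[OF X])
  then have "Z x - Z (A (X x)) - X (A (Z x - Z (A (X x)))) = 0" for x
    by (simp flip: defect_apply)
  then have XV: "X (V x) = Z x - Z (A (X x))" for x
    by (simp add: V_def blinfun.bilinear_simps)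
  have ZV: "Z (V x) = Z (A (Z x)) - Z (A (Z (A (X x))))" for x
    by (simp add: V_def blinfun.bilinear_simps)
  have c: "c t = (id_blinfun + (t *\<^sub>R Z o\<^sub>L A)) o\<^sub>L X o\<^sub>L (id_blinfun + t *\<^sub>R V)" for t
    by (intro blinfun_eqI)
      (simp add: c_def XV ZV blinfun.bilinear_simps power2_eq_square scaleR_diff_right scaleR_add_right)
  obtain r where "r > 0" and r: "ball 0 r \<subseteq> quasi_regular (sandwich A)"
    using small_quasi_regular by blast
  \<comment> \<open>The summand \<open>1\<close> covers \<open>Z = 0\<close>; the choice keeps
    \<open>t *\<^sub>R Z\<close> inside the ball of quasi-regular elements.\<close>
  define \<epsilon> where "\<epsilon> = r / (norm Z + 1)"
  have "\<epsilon> > 0"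
    using \<open>r > 0\<close> by (simp add: \<epsilon>_def add_nonneg_pos)
  have "c t \<in> S" if "t \<in> {-\<epsilon><..<\<epsilon>}" for t
  proof -
    have "\<bar>t\<bar> * (norm Z + 1) < r"
      using that norm_ge_zero[of Z] by (auto simp: \<epsilon>_def field_simps abs_less_iff)
    moreover have "\<bar>t\<bar> * norm Z \<le> \<bar>t\<bar> * (norm Z + 1)"
      by (intro mult_left_mono) auto
    ultimately have "t *\<^sub>R Z \<in> ball 0 r"
      by simp
    with r have "t *\<^sub>R Z \<in> quasi_regular (sandwich A)"
      by blast
    then obtain g where "quasi_inverse (sandwich A) (t *\<^sub>R Z) g"
      by (auto simp: quasi_regular_def)
    then have "invertible_pair (id_blinfun + (t *\<^sub>R Z o\<^sub>L A)) (id_blinfun - (g o\<^sub>L A))"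
      by (rule quasi_inverse_invertible_pair)
    moreover have "invertible_pair (id_blinfun + t *\<^sub>R V) (id_blinfun - t *\<^sub>R V)"
      by (rule square_zero_invertible_pair) (simp add: V_def A blinfun.bilinear_simps)
    ultimately show ?thesis
      unfolding c using \<open>X \<in> S\<close> by (intro orbit)
  qed
  moreover have deriv: "(c has_vector_derivative Z + (2 * t) *\<^sub>R (Z o\<^sub>L V)) (at t)" for t
    unfolding c_def by (auto intro!: derivative_eq_intros)
  then have "c C1_differentiable_on {-\<epsilon><..<\<epsilon>}"
    unfolding C1_differentiable_on_def
    by (intro exI[of _ "\<lambda>t. Z + (2 * t) *\<^sub>R (Z o\<^sub>L V)"]) (auto intro!: continuous_intros)
  moreover have "vector_derivative c (at 0) = Z"
    using vector_derivative_at[OF deriv[of 0]] by simp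
  moreover have "c 0 = X"
    by (simp add: c_def)
  ultimately show ?thesis
    using \<open>\<epsilon> > 0\<close> by blast
qed

lemma tangent_at_M_space:
  assumes "X \<in> S"
  shows "tangent_at S X (M_space X)"
  unfolding tangent_at_def
proof (intro set_eqI iffI)
  fix Z assume "Z \<in> M_space X"
  then show "Z \<in> {vector_derivative c (at 0) | c \<epsilon>. \<epsilon> > (0::real) \<and>
      c C1_differentiable_on {-\<epsilon><..<\<epsilon>} \<and> (\<forall>t\<in>{-\<epsilon><..<\<epsilon>}. c t \<in> S) \<and> c 0 = X}"
    using curve_with_tangent[OF assms] by blast
next
  fix Z
  assume "Z \<in> {vector_derivative c (at 0) | c \<epsilon>. \<epsilon> > (0::real) \<and>
      c C1_differentiable_on {-\<epsilon><..<\<epsilon>} \<and> (\<forall>t\<in>{-\<epsilon><..<\<epsilon>}. c t \<in> S) \<and> c 0 = X}"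
  then obtain c \<epsilon> where c: "Z = vector_derivative c (at 0)" "\<epsilon> > (0::real)"
      "c C1_differentiable_on {-\<epsilon><..<\<epsilon>}" "\<And>t. t \<in> {-\<epsilon><..<\<epsilon>} \<Longrightarrow> c t \<in> S" "c 0 = X"
    by blast
  have "(c has_vector_derivative Z) (at 0)"
    using c(2,3) unfolding c(1) C1_differentiable_on_eq vector_derivative_works[symmetric] by simp
  then show "Z \<in> M_space X"
    using c(2,4,5) by (rule tangent_vector_in_M_space)
qed

end

section \<open>Rigidity of the four classes\<close>

text \<open>\<open>A (X + U) = A X\<close>, and \<open>A\<close> is injective on the range of
  \<open>X\<close>.\<close>

lemma kernel_perturbation:
  fixes X U :: "'a::real_normed_vector \<Rightarrow>\<^sub>L 'b::real_normed_vector"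
  assumes "generalized_inverse X A" "\<And>x. A (U x) = 0"
  shows "kernel (X + U) \<subseteq> kernel X"
proof
  fix x assume "x \<in> kernel (X + U)"
  then have "A (X x + U x) = 0"
    by (simp add: kernel_def blinfun.add_left)
  then have "X (A (X x)) = 0"
    using assms(2) by (simp add: blinfun.add_right)
  then show "x \<in> kernel X"
    using assms(1) by (simp add: kernel_def generalized_inverse_def)
qed

text \<open>\<open>X = X A X = (X + U) A X\<close>.\<close>

lemma op_range_perturbation:
  fixes X U :: "'a::real_normed_vector \<Rightarrow>\<^sub>L 'b::real_normed_vector"
  assumes "generalized_inverse X A" "\<And>y. U (A y) = 0"
  shows "op_range X \<subseteq> op_range (X + U)"
proof -
  have "X x = (X + U) (A (X x))" for x
    using assms by (simp add: generalized_inverse_def blinfun.add_left)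
  then show ?thesis
    by (metis image_subsetI rangeI)
qed

text \<open>\<open>U = U (1 - A X)\<close>, and \<open>1 - A X\<close> maps into the common kernel
  of \<open>X\<close> and \<open>X + U\<close>.\<close>

lemma perturbation_eq_0_if_kernel_eq:
  fixes X U :: "'a::real_normed_vector \<Rightarrow>\<^sub>L 'b::real_normed_vector"
  assumes "generalized_inverse X A" "\<And>y. U (A y) = 0" "kernel (X + U) = kernel X"
  shows "U = 0"
proof (rule blinfun_eqI)
  fix x
  have "x - A (X x) \<in> kernel X"
    using assms(1) by (simp add: kernel_def generalized_inverse_def blinfun.diff_right)
  then have "X (x - A (X x)) = 0" "(X + U) (x - A (X x)) = 0"
    using assms(3) by (auto simp: kernel_def)
  then show "U x = blinfun_apply 0 x"
    by (simp add: blinfun.add_left blinfun.diff_right assms(2))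
qed

text \<open>Values of \<open>U\<close> lie in the range of \<open>X\<close> and in the kernel of
  \<open>A\<close>, which meet only in \<open>0\<close>.\<close>

lemma perturbation_eq_0_if_op_range_eq:
  fixes X U :: "'a::real_normed_vector \<Rightarrow>\<^sub>L 'b::real_normed_vector"
  assumes "generalized_inverse X A" "\<And>x. A (U x) = 0" "op_range (X + U) = op_range X"
  shows "U = 0"
proof (rule blinfun_eqI)
  fix x
  have "(X + U) x - X x \<in> op_range X"
    using assms(3) by (intro subspace_diff[OF subspace_op_range]) auto
  then obtain w where w: "U x = X w"
    by (auto simp: blinfun.add_left)
  then have "U x = X (A (U x))"
    using assms(1) by (simp add: generalized_inverse_def)
  then show "U x = blinfun_apply 0 x"
    by (simp add: assms(2))
qed

lemma rigid_orbits_rank_class: "rigid_orbits (rank_class k)"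
proof
  fix X A U
  assume X: "X \<in> rank_class k" "generalized_inverse X A" "X + U \<in> rank_class k"
    and U: "\<And>x. A (U x) = 0" "\<And>y. U (A y) = 0"
  have "op_range X = op_range (X + U)"
    using X unfolding rank_class_def
    by (intro subspace_eq_of_edim_eq[OF subspace_op_range op_range_perturbation[OF X(2) U(2)]]) auto
  then show "U = 0"
    by (intro perturbation_eq_0_if_op_range_eq[OF X(2) U(1)]) simp
next
  fix X assume "X \<in> rank_class k"
  then show "\<exists>A. generalized_inverse X A"
    by (auto simp: rank_class_def intro: finite_rank_generalized_inverse)
qed (rule rank_class_compose)

text \<open>Either finite index suffices: a finite \<open>m\<close> equates the kernels, a finite
  \<open>n\<close> the ranges.\<close>

lemma rigid_orbits_Phi:
  assumes "(\<exists>k. m = enat k) \<or> (\<exists>k. n = enat k)"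
  shows "rigid_orbits (Phi m n)"
proof
  fix X A U
  assume X: "X \<in> Phi m n" "generalized_inverse X A" "X + U \<in> Phi m n"
    and U: "\<And>x. A (U x) = 0" "\<And>y. U (A y) = 0"
  from assms show "U = 0"
  proof (elim disjE exE)
    fix k assume "m = enat k"
    then have "kernel (X + U) = kernel X"
      using X unfolding Phi_def
      by (intro subspace_eq_of_edim_eq[OF subspace_kernel kernel_perturbation[OF X(2) U(1)]]) auto
    then show "U = 0"
      by (rule perturbation_eq_0_if_kernel_eq[OF X(2) U(2)])
  next
    fix k assume "n = enat k"
    then have "op_range X = op_range (X + U)"
      using X unfolding Phi_def
      by (intro subspace_eq_of_codim_eq[OF op_range_perturbation[OF X(2) U(2)]]) auto
    then show "U = 0"
      by (intro perturbation_eq_0_if_op_range_eq[OF X(2) U(1)]) simp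
  qed
next
  fix X assume "X \<in> Phi m n"
  then show "\<exists>A. generalized_inverse X A"
    by (auto simp: Phi_def intro: double_splitting_generalized_inverse)
qed (rule Phi_compose)

theorem theorem4p2:
  fixes S :: "('e::banach \<Rightarrow>\<^sub>L 'f::banach) set"
  assumes "(\<exists>k::nat. S = rank_class k) \<or>
           (\<exists>m n::nat. S = Phi (enat m) (enat n)) \<or>
           (\<exists>m::nat. S = Phi (enat m) \<infinity>) \<or>
           (\<exists>n::nat. S = Phi \<infinity> (enat n))"
  shows "smooth_submanifold S \<and> (\<forall>X\<in>S. tangent_at S X (M_space X))"
proof -
  from assms have "rigid_orbits S"
    by (auto intro: rigid_orbits_rank_class rigid_orbits_Phi)
  then interpret rigid_orbits S .
  show ?thesis
    using smooth_submanifold tangent_at_M_space by blast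
qed

end
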